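(* Consider the $K$-armed bandit model described in the context, with noise satisfying, for some $\delta>0$, $$\mathbb{E}[\epsilon_t\mid\mathcal{F}_{t-1}]=0,\qquad \mathbb{E}[\epsilon_t^2\mid\mathcal{F}_{t-1}]=\sigma^2,\qquad \sup_{t\ge 1}\mathbb{E}[|\epsilon_t/\sigma|^{2+\delta}\mid\mathcal{F}_{t-1}]<\infty .$$ Let $\beta>0$ and, for $x\ge 1$, $$f(x)=\frac{(\beta(\log 2)^{\beta})^{1/2}}{\{x\,\log(e^2x)\,(\log\log(e^2x))^{1+\beta}\}^{1/2}}.$$ Let $s_0>0$ be $\mathcal{F}_0$-measurable (possibly depending on $n$), and for each arm $k$ and round $t$ define $$s_{t,k}=s_0+\sum_{i=1}^t x_{i,k}^2,\qquad w_{t,k}=f\Big(\frac{s_{t,k}}{s_0}\Big)\frac{x_{t,k}}{\sqrt{s_0}},$$ where $x_{t,k}$ is the $k$-th coordinate of $\boldsymbol{x}_t$. Suppose that for some $k\in[K]$, $1/s_0+s_0/s_{n,k}=o_p(1)$ as $n\to\infty$. Let $\widehat\theta_{\mathrm{ALEE},k}$ be the $k$-th coordinate of the ALEE estimator with weights $\boldsymbol{w}_t=(w_{t,1},\ldots,w_{t,K})^\top$, and let $\widehat\sigma$ be a consistent estimator of $\sigma$. Then $$\sqrt{\frac{4\beta(\log 2)^\beta}{\log(s_{n,k}/s_0)\,\{\log\log(s_{n,k}/s_0)\}^{1+\beta}}}\cdot\frac{\sqrt{s_{n,k}}\,(\widehat\theta_{\mathrm{ALEE},k}-\theta_k^* )}{\widehat\sigma}\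 \overset{d}{\longrightarrow}\ \mathcal{N}(0,1).$$
   Context: $K$-armed bandit model: $K$ is fixed, $\boldsymbol{\theta}^*=(\theta_1^*,\ldots,\theta_K^* )^\top\in\mathbb{R}^K$ is the deterministic vector of arm means, $\sigma>0$, and $y_t=\boldsymbol{x}_t^\top\boldsymbol{\theta}^*+\epsilon_t$ for $t\in[n]$, where each $\boldsymbol{x}_t$ is one of the standard basis vectors $\boldsymbol{e}_1,\ldots,\boldsymbol{e}_K$ of $\mathbb{R}^K$ ($\boldsymbol{x}_t=\boldsymbol{e}_k$ means arm $k$ is pulled at round $t$). There is an increasing sequence of $\sigma$-fields $\{\mathcal{F}_t\}_{t\ge 0}$ such that $\sigma(\boldsymbol{x}_1,y_1,\ldots,\boldsymbol{x}_{t-1},y_{t-1},\boldsymbol{x}_t)\subseteq\mathcal{F}_{t-1}$ for each $t$ (so $\boldsymbol{x}_t$ is $\mathcal{F}_{t-1}$-measurable and $y_t,\epsilon_t$ are $\mathcal{F}_t$-measurable). The ALEE (adaptive linear estimating equations) estimator with weights $\boldsymbol{w}_t$ is a solution $\widehat{\boldsymbol{\theta}}_{\mathrm{ALEE}}$ of $\sum_{t=1}^n\boldsymbol{w}_t(y_t-\boldsymbol{x}_t^\top\widehat{\boldsymbol{\theta}}_{\mathrm{ALEE}})=\mathbf{0}$; with the weights used here its $k$-th coordinate satisfies $\sum_{t=1}^n w_{t,k}(y_t-x_{t,k}\widehat\theta_{\mathrm{ALEE},k})=0$. All asymptotics are as $n\to\infty$; $o_p(1)$ denotes convergence to zero in probability.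 The normalizing factor is well defined on the event $\{s_{n,k}/s_0>e\}$, whose probability tends to one (its value elsewhere is irrelevant). A consistent estimator of $\sigma$ is a sequence $\widehat\sigma=\widehat\sigma_n$ converging to $\sigma$ in probability. *)

theory Defs
  imports "HOL-Probability.Probability"
begin

definition conv_in_prob :: "'a measure \<Rightarrow> (nat \<Rightarrow> 'a \<Rightarrow> real) \<Rightarrow> real \<Rightarrow> bool" where
  "conv_in_prob M X c \<longleftrightarrow>
     (\<forall>e>0. (\<lambda>n. measure M {\<omega> \<in> space M. \<bar>X n \<omega> - c\<bar> > e}) \<longlonglongrightarrow> 0)"

text \<open>Rounds are numbered from 1; index 0 of \<open>x\<close> and \<open>y\<close> is never used.
  \<open>history_algebra M x y t\<close> is
  \<open>\<sigma>(x\<^sub>1, y\<^sub>1, \<dots>, x\<^bsub>t-1\<^esub>, y\<^bsub>t-1\<^esub>, x\<^sub>t)\<close>.\<close>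

definition history_algebra ::
  "'a measure \<Rightarrow> (nat \<Rightarrow> 'a \<Rightarrow> real ^ 'k) \<Rightarrow> (nat \<Rightarrow> 'a \<Rightarrow> real) \<Rightarrow> nat \<Rightarrow> 'a measure" where
  "history_algebra M x y t = sigma (space M)
     ({x i -` A \<inter> space M | i A. i \<in> {1..t} \<and> A \<in> sets borel} \<union>
      {y i -` B \<inter> space M | i B. i \<in> {1..<t} \<and> B \<in> sets borel})"

definition alee_f :: "real \<Rightarrow> real \<Rightarrow> real" where
  "alee_f \<beta> z = sqrt (\<beta> * ln 2 powr \<beta>) /
     sqrt (z * ln (exp 2 * z) * ln (ln (exp 2 * z)) powr (1 + \<beta>))"

definition alee_s :: "('a \<Rightarrow> real) \<Rightarrow> (nat \<Rightarrow> 'a \<Rightarrow> real ^ 'k) \<Rightarrow> nat \<Rightarrow> 'k \<Rightarrow> 'a \<Rightarrow> real" where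
  "alee_s s0 x t k \<omega> = s0 \<omega> + (\<Sum>i=1..t. (x i \<omega> $ k)\<^sup>2)"

definition alee_w ::
  "real \<Rightarrow> ('a \<Rightarrow> real) \<Rightarrow> (nat \<Rightarrow> 'a \<Rightarrow> real ^ 'k) \<Rightarrow> nat \<Rightarrow> 'a \<Rightarrow> real ^ 'k" where
  "alee_w \<beta> s0 x t \<omega> =
     (\<chi> k. alee_f \<beta> (alee_s s0 x t k \<omega> / s0 \<omega>) * (x t \<omega> $ k / sqrt (s0 \<omega>)))"

definition is_ALEE ::
  "(nat \<Rightarrow> 'a \<Rightarrow> real ^ 'k) \<Rightarrow> (nat \<Rightarrow> 'a \<Rightarrow> real ^ 'k) \<Rightarrow> (nat \<Rightarrow> 'a \<Rightarrow> real) \<Rightarrow> nat \<Rightarrow> 'a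
     \<Rightarrow> real ^ 'k \<Rightarrow> bool" where
  "is_ALEE w x y n \<omega> \<theta> \<longleftrightarrow> (\<Sum>t=1..n. (y t \<omega> - x t \<omega> \<bullet> \<theta>) *\<^sub>R w t \<omega>) = 0"

end

theory Submission
  imports Defs "HOL-Real_Asymp.Real_Asymp"
begin

text \<open>
  Write \<open>f = alee_f \<beta>\<close> and let \<open>r\<close> be the ratio of \<open>s\<^sub>n\<^sub>,\<^sub>k\<close> to \<open>s\<^sub>0\<close>. Each pull of arm \<open>k\<close> moves the ratio by
  \<open>1/s\<^sub>0\<close>, so sums of decreasing functions of the ratio are right Riemann sums of mesh \<open>1/s\<^sub>0\<close>. Since the
  integral of \<open>f\<^sup>2\<close> over \<open>[1,\<infinity>)\<close> is 1, the squared weights always sum to at most 1 and their sum tends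
  to 1 in probability, while the largest weight is at most \<open>f 1 / sqrt s\<^sub>0\<close>. A martingale central limit
  theorem, proved by comparing \<open>exp (i u S\<^sub>t + u\<^sup>2 V\<^sub>t / 2)\<close> with a martingale, gives a Gaussian limit for
  the weighted noise. The estimating equation expresses the error as the weighted noise divided by
  \<open>sqrt s\<^sub>0\<close> times a Riemann sum of \<open>f\<close>, which is equivalent to \<open>2 r f r\<close>; Slutsky's theorem concludes.
\<close>

section \<open>The weight function\<close>

text \<open>The weights are designed so that their accumulated squares depend on the path, up to a
  mesh error, only through the ratio, and stay near 1 for every large ratio, whatever its law. For
  that f must be square integrable, but only just: up to logarithms it is z^(-1/2), so its integral
  still diverges and grows like 2 r f(r); the square of this 2 is the 4 in the normalizing factor.
  The e^2 inside the logarithms keeps them positive down to z = 1. Two features shape the CLT. The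
  squared weights sum to at most 1 on every path, so the compensator is bounded and no stopping time
  enters. The conditional moment bound is merely almost surely finite, so the noise is split at a
  level m, and n tends to infinity before m does.\<close>

text \<open>By the mean value theorem, the increment of \<open>G\<close> over one pull lies between
  the right and the left endpoint value of \<open>g\<close>, times the mesh \<open>1 / s\<close>.
  The differences of left and right values telescope, so the whole error is at most
  \<open>(g 1 - g (r n)) / s\<close>.\<close>

lemma antimono_sum_bounds:
  fixes g G :: "real \<Rightarrow> real" and d :: "nat \<Rightarrow> real"
  assumes "s > 0"
    and anti: "\<And>a b. 1 \<le> a \<Longrightarrow> a \<le> b \<Longrightarrow> g b \<le> g a"
    and deriv: "\<And>z. z \<ge> 1 \<Longrightarrow> (G has_real_derivative g z) (at z)"
    and d: "\<And>i. i \<ge> 1 \<Longrightarrow> d i = 0 \<or> d i = 1"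
  defines "r \<equiv> \<lambda>t. (s + (\<Sum>i=1..t. d i)) / s"
  shows "(\<Sum>t=1..n. g (r t) * (d t / s)) \<le> G (r n) - G 1"
    and "G (r n) - G 1 - (g 1 - g (r n)) / s \<le> (\<Sum>t=1..n. g (r t) * (d t / s))"
proof -
  have r_ge: "1 \<le> r t" for t
  proof -
    have "0 \<le> (\<Sum>i=1..t. d i)" using d by (intro sum_nonneg) force
    then show ?thesis using \<open>s > 0\<close> by (simp add: r_def)
  qed
  have r_Suc: "r (Suc t) = r t + d (Suc t) / s" for t
    by (simp add: r_def add_divide_distrib)
  have incr: "g (r (Suc t)) * (d (Suc t) / s) \<le> G (r (Suc t)) - G (r t)
    \<and> G (r (Suc t)) - G (r t) \<le> g (r t) * (d (Suc t) / s)" for t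
  proof (cases "d (Suc t) = 0")
    case False
    then have d1: "d (Suc t) = 1" using d[of "Suc t"] by simp
    have less: "r t < r (Suc t)" using r_Suc[of t] d1 \<open>s > 0\<close> by simp
    obtain z where z: "r t < z" "z < r (Suc t)"
      "G (r (Suc t)) - G (r t) = (r (Suc t) - r t) * g z"
      using MVT2[OF less, of G g] deriv r_ge by (meson order_trans)
    have "g (r (Suc t)) \<le> g z" "g z \<le> g (r t)"
      using anti[of z "r (Suc t)"] anti[of "r t" z] z r_ge[of t] by auto
    then show ?thesis using z(3) r_Suc[of t] d1 \<open>s > 0\<close> by (simp add: divide_right_mono)
  qed (simp add: r_Suc)
  show "(\<Sum>t=1..n. g (r t) * (d t / s)) \<le> G (r n) - G 1"
  proof (induction n)
    case 0 then show ?case using \<open>s > 0\<close> by (simp add: r_def)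
  next
    case (Suc n) then show ?case using incr[of n] by simp
  qed
  show "G (r n) - G 1 - (g 1 - g (r n)) / s \<le> (\<Sum>t=1..n. g (r t) * (d t / s))"
  proof (induction n)
    case 0 then show ?case using \<open>s > 0\<close> by (simp add: r_def)
  next
    case (Suc n)
    \<comment> \<open>The gap between the left and right endpoint rules in one round; without a pull
      both sides are 0.\<close>
    have "g (r n) * (d (Suc n) / s) - g (r (Suc n)) * (d (Suc n) / s) \<le> (g (r n) - g (r (Suc n))) / s"
      using d[of "Suc n"] by (auto simp: r_Suc diff_divide_distrib)
    with Suc incr[of n] show ?case by (simp add: diff_divide_distrib)
  qed
qed

section \<open>Calculus of the weight function and its primitives\<close>

text \<open>The calculus takes place on the open half-line z > 1/2, so that derivatives at z = 1,
  where the Riemann sums start, are two-sided. There ln z > -ln 2 > -1 keeps the iterated logarithm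
  positive.\<close>

lemma ln_plus_2_gt_1: "1 < 2 + ln z" if "z > 1/2" for z :: real
proof -
  have "ln (1/2) < ln z" using that by (subst ln_less_cancel_iff) auto
  then show ?thesis using ln_2_less_1 by (simp add: ln_div)
qed

text \<open>In this form positivity is immediate and the logarithmic derivative can be read
  off.\<close>

lemma alee_f_eq_exp:
  assumes "z > 1/2" "\<beta> > 0"
  shows "alee_f \<beta> z = sqrt (\<beta> * ln 2 powr \<beta>) *
    exp (- (ln z + ln (2 + ln z) + (1 + \<beta>) * ln (ln (2 + ln z))) / 2)"
proof -
  define q where "q = ln z + ln (2 + ln z) + (1 + \<beta>) * ln (ln (2 + ln z))"
  have L: "1 < 2 + ln z" using ln_plus_2_gt_1 assms by simp
  then have LL: "0 < ln (2 + ln z)" by simp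
  have "ln (exp 2 * z) = 2 + ln z" using assms by (simp add: ln_mult)
  then have "z * ln (exp 2 * z) * ln (ln (exp 2 * z)) powr (1 + \<beta>) = exp q"
    using L LL assms by (simp add: q_def exp_add powr_def)
  moreover have "sqrt (exp q) = exp (q / 2)"
    by (rule real_sqrt_unique) (simp_all add: power2_eq_square mult_exp_exp)
  ultimately have "alee_f \<beta> z = sqrt (\<beta> * ln 2 powr \<beta>) / exp (q / 2)"
    unfolding alee_f_def by (simp only:)
  moreover have "exp (- q / 2) = inverse (exp (q / 2))" by (metis exp_minus minus_divide_left)
  ultimately show ?thesis unfolding q_def[symmetric] by (simp only: divide_inverse)
qed

lemma alee_f_pos:
  assumes "z > 1/2" "\<beta> > 0"
  shows "0 < alee_f \<beta> z"
  using assms by (simp add: alee_f_eq_exp)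

text \<open>In the logarithmic derivative the factor z^(-1/2) contributes the leading 1; each of the
  two logarithmic factors contributes a term that vanishes at infinity.\<close>

lemma DERIV_alee_f:
  assumes "z > 1/2" "\<beta> > 0"
  shows "(alee_f \<beta> has_real_derivative
    - alee_f \<beta> z * (1 + 1 / (2 + ln z) + (1 + \<beta>) / ((2 + ln z) * ln (2 + ln z))) / (2 * z)) (at z)"
proof (rule has_field_derivative_transform_within_open)
  show "open {1/2::real<..}" "z \<in> {1/2<..}" using assms by auto
  have L: "1 < 2 + ln z" using ln_plus_2_gt_1 assms by simp
  then have LL: "0 < ln (2 + ln z)" by simp
  have "((\<lambda>z. - (ln z + ln (2 + ln z) + (1 + \<beta>) * ln (ln (2 + ln z))) / 2) has_real_derivative
      - (1 + 1 / (2 + ln z) + (1 + \<beta>) / ((2 + ln z) * ln (2 + ln z))) / (2 * z)) (at z)"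
  proof -
    have gen: "- (1 / z + 1 / z / a + b * (1 / z / a / c)) / 2 = - (1 + 1 / a + b / (a * c)) / (2 * z)"
      if "a \<noteq> 0" "c \<noteq> 0" for a b c :: real
      using that assms(1) by (simp add: field_simps)
    have eq: "- (1 / z + 1 / z / (2 + ln z) + (1 + \<beta>) * (1 / z / (2 + ln z) / ln (2 + ln z))) / 2
        = - (1 + 1 / (2 + ln z) + (1 + \<beta>) / ((2 + ln z) * ln (2 + ln z))) / (2 * z)"
      by (rule gen) (use L LL in auto)
    have "((\<lambda>z. - (ln z + ln (2 + ln z) + (1 + \<beta>) * ln (ln (2 + ln z)))) has_real_derivative
        - (1 / z + 1 / z / (2 + ln z) + (1 + \<beta>) * (1 / z / (2 + ln z) / ln (2 + ln z)))) (at z)"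
      using L LL assms(1) by (auto intro!: derivative_eq_intros simp: mult_ac)
    from DERIV_cdivide[OF this, of 2] show ?thesis unfolding eq .
  qed
  note deriv = DERIV_cmult[OF DERIV_fun_exp[OF this], of "sqrt (\<beta> * ln 2 powr \<beta>)"]
  show "((\<lambda>z. sqrt (\<beta> * ln 2 powr \<beta>) *
      exp (- (ln z + ln (2 + ln z) + (1 + \<beta>) * ln (ln (2 + ln z))) / 2)) has_real_derivative
    - alee_f \<beta> z * (1 + 1 / (2 + ln z) + (1 + \<beta>) / ((2 + ln z) * ln (2 + ln z))) / (2 * z)) (at z)"
  proof -
    have "C * (E * (- X / Y)) = - (C * E) * X / Y" for C E X Y :: real by simp
    then show ?thesis using deriv unfolding alee_f_eq_exp[OF assms] by (simp only:)
  qed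
qed (use assms in \<open>auto simp: alee_f_eq_exp\<close>)

lemma alee_f_antimono:
  assumes "\<beta> > 0" "1 \<le> a" "a \<le> b"
  shows "alee_f \<beta> b \<le> alee_f \<beta> a"
proof (rule DERIV_nonpos_imp_nonincreasing[OF \<open>a \<le> b\<close>])
  fix z assume z: "a \<le> z" "z \<le> b"
  have L: "1 < 2 + ln z" using ln_plus_2_gt_1[of z] assms z by simp
  then have "0 < ln (2 + ln z)" by simp
  then have "- alee_f \<beta> z * (1 + 1 / (2 + ln z) + (1 + \<beta>) / ((2 + ln z) * ln (2 + ln z))) / (2 * z) \<le> 0"
    using L alee_f_pos[of z \<beta>] assms z
    by (intro divide_nonpos_pos mult_nonpos_nonneg add_nonneg_nonneg divide_nonneg_pos) auto
  then show "\<exists>y. (alee_f \<beta> has_real_derivative y) (at z) \<and> y \<le> 0"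
    using DERIV_alee_f[of z \<beta>] assms z by auto
qed

text \<open>Substituting v = ln (2 + ln z) turns f^2 dz into beta (ln 2)^beta v^(-1-beta) dv. The
  primitive is -1 at z = 1, where v = ln 2, and tends to 0 at infinity; this is the origin of the
  constant in f.\<close>

lemma DERIV_alee_f_sq_primitive:
  assumes "z > 1/2" "\<beta> > 0"
  shows "((\<lambda>z. - (ln 2 powr \<beta>) * ln (2 + ln z) powr (- \<beta>)) has_real_derivative
    (alee_f \<beta> z)\<^sup>2) (at z)"
proof -
  have L: "1 < 2 + ln z" using ln_plus_2_gt_1 assms by simp
  then have LL: "0 < ln (2 + ln z)" by simp
  have "ln (exp 2 * z) = 2 + ln z" using assms by (simp add: ln_mult)
  then have "(alee_f \<beta> z)\<^sup>2 = \<beta> * ln 2 powr \<beta> / (z * (2 + ln z) * ln (2 + ln z) powr (1 + \<beta>))"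
    using L LL assms by (simp add: alee_f_def power_divide)
  also have "\<dots> = \<beta> * ln 2 powr \<beta> * ln (2 + ln z) powr (- \<beta> - 1) / (z * (2 + ln z))"
    using LL by (simp add: powr_diff powr_minus powr_add field_simps)
  finally show ?thesis
    using L LL assms by (auto intro!: derivative_eq_intros simp: field_simps)
qed

lemma alee_f_primitive:
  assumes "\<beta> > 0"
  obtains G where "\<And>z. z \<ge> 1 \<Longrightarrow> (G has_real_derivative alee_f \<beta> z) (at z)"
proof
  fix z :: real assume z: "z \<ge> 1"
  \<comment> \<open>The base point 3/4 lies strictly between 1/2 and 1, which puts z = 1 in the
    interior of the interval.\<close>
  have "continuous_on {3/4..z+1} (alee_f \<beta>)"
    by (rule DERIV_continuous_on, rule has_field_derivative_at_within, rule DERIV_alee_f)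
      (use assms in auto)
  then have "((\<lambda>z. integral {3/4..z} (alee_f \<beta>)) has_real_derivative alee_f \<beta> z) (at z within {3/4..z+1})"
    by (rule integral_has_real_derivative) (use z in auto)
  then show "((\<lambda>z. integral {3/4..z} (alee_f \<beta>)) has_real_derivative alee_f \<beta> z) (at z)"
    using z by (subst (asm) at_within_interior) auto
qed

section \<open>Asymptotics of the normalizing factor\<close>

text \<open>The normalizing factor as a function of the ratio alone: the root of
  \<open>alee_s\<close> splits into \<open>sqrt r\<close> and \<open>sqrt s0\<close>, and the latter
  is left with the estimation error.\<close>

definition alee_scale :: "real \<Rightarrow> real \<Rightarrow> real" where
  "alee_scale \<beta> r = sqrt (4 * \<beta> * ln 2 powr \<beta> / (ln r * ln (ln r) powr (1 + \<beta>))) * sqrt r"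

text \<open>The square of 2 r f(r) is 4 beta (ln 2)^beta r divided by the logarithmic factors of e^2
  r, so the two sides differ only by the e^2 inside the logarithms.\<close>

lemma alee_scale_asymp:
  assumes "\<beta> > 0"
  shows "((\<lambda>r. alee_scale \<beta> r / (2 * r * alee_f \<beta> r)) \<longlongrightarrow> 1) at_top"
proof -
  have "((\<lambda>r::real. (2 + ln r) / ln r) \<longlongrightarrow> 1) at_top" by real_asymp
  moreover have "((\<lambda>r::real. ln (2 + ln r) / ln (ln r)) \<longlongrightarrow> 1) at_top" by real_asymp
  ultimately have "((\<lambda>r. sqrt ((2 + ln r) / ln r * (ln (2 + ln r) / ln (ln r)) powr (1 + \<beta>)))
    \<longlongrightarrow> sqrt (1 * 1 powr (1 + \<beta>))) at_top"
    by (intro tendsto_intros) auto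
  \<comment> \<open>Beyond exp (exp 1) both logarithms in \<open>alee_scale\<close> are positive, so
    roots and powers may be split.\<close>
  moreover have "\<forall>\<^sub>F r in at_top. sqrt ((2 + ln r) / ln r * (ln (2 + ln r) / ln (ln r)) powr (1 + \<beta>))
    = alee_scale \<beta> r / (2 * r * alee_f \<beta> r)"
    using eventually_gt_at_top[of "exp (exp 1)"]
  proof eventually_elim
    case (elim r)
    have r: "r > 0" using elim exp_gt_zero[of "exp (1::real)"] by linarith
    have "exp 1 < ln r" using elim r by (metis exp_less_cancel_iff exp_ln)
    moreover have "(1::real) < exp 1" by simp
    ultimately have l: "1 < ln r" by linarith
    then have ll: "0 < ln (ln r)" "0 < ln (2 + ln r)" by simp_all
    have le: "ln (exp 2 * r) = 2 + ln r" using r by (simp add: ln_mult)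
    have "sqrt r * sqrt r = r" using r by simp
    then have "sqrt r * (sqrt r * a) / (b * r) = a / b" for a b
      using r by (metis mult.assoc mult.commute mult_divide_mult_cancel_right less_irrefl)
    then show ?case using r l ll assms
      by (simp add: alee_scale_def alee_f_def le real_sqrt_mult real_sqrt_divide powr_divide flip: mult.assoc)
  qed
  ultimately show ?thesis by (simp add: filterlim_cong)
qed

text \<open>Since f decreases, \<open>G r - G 1\<close> is at least (r - 1) f(r), which is sqrt r up
  to logarithms.\<close>

lemma alee_f_primitive_at_top:
  assumes "\<beta> > 0" and G: "\<And>z. z \<ge> 1 \<Longrightarrow> (G has_real_derivative alee_f \<beta> z) (at z)"
  shows "filterlim G at_top at_top"
proof (rule filterlim_at_top_mono)
  have *: "filterlim (\<lambda>r::real. (r - 1) / sqrt (r * (2 + ln r) * ln (2 + ln r) powr (1 + \<beta>))) at_top at_top"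
    using assms(1) by real_asymp
  have "filterlim (\<lambda>r. sqrt (\<beta> * ln 2 powr \<beta>) * ((r - 1) / sqrt (r * (2 + ln r) * ln (2 + ln r) powr (1 + \<beta>)))) at_top at_top"
    by (rule filterlim_tendsto_pos_mult_at_top[OF tendsto_const _ *]) (use assms(1) in simp)
  from filterlim_tendsto_add_at_top[OF tendsto_const this]
  show "filterlim (\<lambda>r. G 1 + sqrt (\<beta> * ln 2 powr \<beta>) * ((r - 1) / sqrt (r * (2 + ln r) * ln (2 + ln r) powr (1 + \<beta>)))) at_top at_top" .
  show "\<forall>\<^sub>F r in at_top. G 1 + sqrt (\<beta> * ln 2 powr \<beta>) * ((r - 1) / sqrt (r * (2 + ln r) * ln (2 + ln r) powr (1 + \<beta>))) \<le> G r"
    using eventually_gt_at_top[of 1]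
  proof eventually_elim
    case (elim r)
    obtain z where z: "1 < z" "z < r" "G r - G 1 = (r - 1) * alee_f \<beta> z"
      using MVT2[OF elim, of G "alee_f \<beta>"] G by auto
    then have "(r - 1) * alee_f \<beta> r \<le> G r - G 1"
      using alee_f_antimono[of \<beta> z r] assms(1) by simp
    moreover have "ln (exp 2 * r) = 2 + ln r" using elim by (simp add: ln_mult)
    ultimately show ?case by (simp add: alee_f_def mult.commute)
  qed
qed

text \<open>Since \<open>2 z f z\<close> has derivative \<open>f z (1 - o(1))\<close>, L'Hospital's rule compares it with the primitive of \<open>f\<close>.\<close>
lemma alee_scale_primitive:
  assumes "\<beta> > 0" and G: "\<And>z. z \<ge> 1 \<Longrightarrow> (G has_real_derivative alee_f \<beta> z) (at z)"
  shows "((\<lambda>r. alee_scale \<beta> r / G r) \<longlongrightarrow> 1) at_top"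
proof -
  define P' where "P' z = 2 * alee_f \<beta> z + 2 * z *
    (- alee_f \<beta> z * (1 + 1 / (2 + ln z) + (1 + \<beta>) / ((2 + ln z) * ln (2 + ln z))) / (2 * z))" for z
  have G_top: "filterlim G at_top at_top" using alee_f_primitive_at_top assms .
  have pos: "\<forall>\<^sub>F z in at_top. 0 < alee_f \<beta> z"
    using eventually_gt_at_top[of 1] by eventually_elim (simp add: alee_f_pos assms(1))
  have "((\<lambda>r. 2 * r * alee_f \<beta> r / G r) \<longlongrightarrow> 1) at_top"
  proof (rule lhospital_at_top_at_top[where f' = P' and g' = "alee_f \<beta>"])
    show "\<forall>\<^sub>F z in at_top. alee_f \<beta> z \<noteq> 0" using pos by eventually_elim simp
    show "\<forall>\<^sub>F z in at_top. ((\<lambda>r. 2 * r * alee_f \<beta> r) has_real_derivative P' z) (at z)"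
      using eventually_gt_at_top[of 1]
    proof eventually_elim
      case (elim z)
      then show ?case unfolding P'_def
        using DERIV_mult[OF DERIV_cmult[OF DERIV_ident, of 2] DERIV_alee_f[of z \<beta>]] assms(1)
        by (simp add: algebra_simps)
    qed
    show "\<forall>\<^sub>F z in at_top. (G has_real_derivative alee_f \<beta> z) (at z)"
      using eventually_ge_at_top[of 1] by eventually_elim (rule G)
    have "((\<lambda>z. 1 - 1 / (2 + ln z) - (1 + \<beta>) * (1 / ((2 + ln z) * ln (2 + ln z)))) \<longlongrightarrow> 1 - 0 - (1 + \<beta>) * 0) at_top"
      by (intro tendsto_diff tendsto_mult tendsto_const; real_asymp)
    moreover have "\<forall>\<^sub>F z in at_top. 1 - 1 / (2 + ln z) - (1 + \<beta>) * (1 / ((2 + ln z) * ln (2 + ln z))) = P' z / alee_f \<beta> z"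
      using pos eventually_gt_at_top[of 1]
    proof eventually_elim
      case (elim z)
      have "P' z = alee_f \<beta> z * (1 - 1 / (2 + ln z) - (1 + \<beta>) * (1 / ((2 + ln z) * ln (2 + ln z))))"
      proof -
        have cancel: "2 * z * (- f * X / (2 * z)) = - f * X" for f X using elim by simp
        have "2 * f + - f * (1 + a + b / c) = f * (1 - a - b * (1 / c))" for f a b c :: real
          by (simp add: algebra_simps)
        then show ?thesis unfolding P'_def cancel .
      qed
      then show ?case using elim by simp
    qed
    ultimately show "((\<lambda>z. P' z / alee_f \<beta> z) \<longlongrightarrow> 1) at_top" by (simp add: filterlim_cong)
  qed (fact G_top)
  from tendsto_mult[OF alee_scale_asymp[OF assms(1)] this]
  have "((\<lambda>r. alee_scale \<beta> r / (2 * r * alee_f \<beta> r) * (2 * r * alee_f \<beta> r / G r)) \<longlongrightarrow> 1) at_top"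
    by simp
  moreover have "\<forall>\<^sub>F r in at_top. alee_scale \<beta> r / (2 * r * alee_f \<beta> r) * (2 * r * alee_f \<beta> r / G r) = alee_scale \<beta> r / G r"
    using pos eventually_gt_at_top[of 1] by eventually_elim simp
  ultimately show ?thesis by (rule Lim_transform_eventually)
qed

text \<open>The limit in \<open>alee_scale_primitive\<close> holds for every primitive, in
  particular for \<open>G\<close> shifted by \<open>c\<close>, and monotonicity in the denominator
  covers everything in between. The quantifier over \<open>D\<close> is there because the Riemann
  sum to be inserted is random and known only up to a bounded error.\<close>

lemma alee_scale_ratio:
  assumes "\<beta> > 0" "e > 0" and G: "\<And>z. z \<ge> 1 \<Longrightarrow> (G has_real_derivative alee_f \<beta> z) (at z)"
  shows "\<forall>\<^sub>F r in at_top. \<forall>D. G r - c \<le> D \<and> D \<le> G r \<longrightarrow> 0 < D \<and> \<bar>alee_scale \<beta> r / D - 1\<bar> < e"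
proof -
  have G_top: "filterlim G at_top at_top" using alee_f_primitive_at_top assms(1) G .
  have 1: "((\<lambda>r. alee_scale \<beta> r / G r) \<longlongrightarrow> 1) at_top" using alee_scale_primitive assms(1) G .
  have 2: "((\<lambda>r. alee_scale \<beta> r / (G r - c)) \<longlongrightarrow> 1) at_top"
    by (rule alee_scale_primitive[OF assms(1)]) (auto intro!: derivative_eq_intros G)
  have "\<forall>\<^sub>F r in at_top. c < G r" "\<forall>\<^sub>F r in at_top. 0 < G r"
    using G_top by (simp_all add: filterlim_at_top_dense)
  with tendstoD[OF 1 assms(2)] tendstoD[OF 2 assms(2)] eventually_gt_at_top[of "exp (1::real)"]
  show ?thesis
  proof eventually_elim
    case (elim r)
    \<comment> \<open>The root of a negative real is negative in HOL, so the sign of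
      \<open>alee_scale\<close> has to come from that of \<open>ln r\<close>.\<close>
    have "0 < r" using elim(3) exp_gt_zero[of "1::real"] by linarith
    then have "1 < ln r" using elim(3) by (metis exp_less_cancel_iff exp_ln)
    then have "1 \<le> r" using \<open>0 < r\<close> by (metis ln_ge_zero_iff less_imp_le zero_less_one order_less_trans)
    with \<open>1 < ln r\<close> have nn: "0 \<le> alee_scale \<beta> r" 
      using assms(1) \<open>0 < r\<close>
      by (auto simp: alee_scale_def intro!: mult_nonneg_nonneg divide_nonneg_nonneg)
    show ?case
    proof (intro allI impI)
      fix D assume D: "G r - c \<le> D \<and> D \<le> G r"
      then have "alee_scale \<beta> r / D \<le> alee_scale \<beta> r / (G r - c)" "alee_scale \<beta> r / G r \<le> alee_scale \<beta> r / D"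
        using nn elim by (auto intro!: divide_left_mono mult_pos_pos)
      then show "0 < D \<and> \<bar>alee_scale \<beta> r / D - 1\<bar> < e" using elim D by (simp add: dist_real_def)
    qed
  qed
qed

section \<open>Convergence in probability\<close>

lemma norm_integral_le:
  fixes f :: "'a \<Rightarrow> 'b::{banach, second_countable_topology}"
  assumes "integrable M f" "integrable M g" "\<And>\<omega>. \<omega> \<in> space M \<Longrightarrow> norm (f \<omega>) \<le> g \<omega>"
  shows "norm (\<integral>\<omega>. f \<omega> \<partial>M) \<le> (\<integral>\<omega>. g \<omega> \<partial>M)"
  using assms by (intro order_trans[OF integral_norm_bound integral_mono]) auto

text \<open>A substitute for continuous mapping: pointwise epsilon-d implications, uniform in
  \<open>n\<close> and \<open>\<omega>\<close>, carry convergence in probability over to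
  \<open>X\<close>, which may behave arbitrarily where \<open>Y\<close> or \<open>Z\<close> is far
  from its limit.\<close>

lemma conv_in_prob_le2:
  assumes "prob_space M" and Y: "conv_in_prob M Y a" and Z: "conv_in_prob M Z b"
    and [measurable]: "\<And>n. Y n \<in> borel_measurable M" "\<And>n. Z n \<in> borel_measurable M"
    and imp: "\<And>\<epsilon>. \<epsilon> > 0 \<Longrightarrow> \<exists>d>0. \<forall>n. \<forall>\<omega>\<in>space M. \<bar>X n \<omega> - c\<bar> > \<epsilon> \<longrightarrow> \<bar>Y n \<omega> - a\<bar> > d \<or> \<bar>Z n \<omega> - b\<bar> > d"
  shows "conv_in_prob M X c"
  unfolding conv_in_prob_def
proof (intro allI impI)
  interpret prob_space M by fact
  fix \<epsilon> :: real assume "\<epsilon> > 0"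
  then obtain d where d: "d > 0"
    and *: "\<And>n \<omega>. \<omega> \<in> space M \<Longrightarrow> \<bar>X n \<omega> - c\<bar> > \<epsilon> \<Longrightarrow> \<bar>Y n \<omega> - a\<bar> > d \<or> \<bar>Z n \<omega> - b\<bar> > d"
    using imp by meson
  have "(\<lambda>n. prob {\<omega> \<in> space M. \<bar>Y n \<omega> - a\<bar> > d} + prob {\<omega> \<in> space M. \<bar>Z n \<omega> - b\<bar> > d}) \<longlonglongrightarrow> 0 + 0"
    using Y Z d unfolding conv_in_prob_def by (intro tendsto_add) auto
  then have lim: "(\<lambda>n. prob {\<omega> \<in> space M. \<bar>Y n \<omega> - a\<bar> > d} + prob {\<omega> \<in> space M. \<bar>Z n \<omega> - b\<bar> > d}) \<longlonglongrightarrow> 0"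
    by simp
  show "(\<lambda>n. prob {\<omega> \<in> space M. \<bar>X n \<omega> - c\<bar> > \<epsilon>}) \<longlonglongrightarrow> 0"
  proof (rule tendsto_sandwich[OF always_eventually always_eventually tendsto_const lim]; rule allI)
    fix n
    have "prob {\<omega> \<in> space M. \<bar>X n \<omega> - c\<bar> > \<epsilon>}
      \<le> prob ({\<omega> \<in> space M. \<bar>Y n \<omega> - a\<bar> > d} \<union> {\<omega> \<in> space M. \<bar>Z n \<omega> - b\<bar> > d})"
      using * by (intro finite_measure_mono) auto
    also have "\<dots> \<le> prob {\<omega> \<in> space M. \<bar>Y n \<omega> - a\<bar> > d} + prob {\<omega> \<in> space M. \<bar>Z n \<omega> - b\<bar> > d}"
      by (intro measure_Un_le) auto
    finally show "prob {\<omega> \<in> space M. \<bar>X n \<omega> - c\<bar> > \<epsilon>} \<le> \<dots>" .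
  qed simp
qed

lemma conv_in_prob_le:
  assumes "prob_space M" and Y: "conv_in_prob M Y a" and "\<And>n. Y n \<in> borel_measurable M"
    and imp: "\<And>\<epsilon>. \<epsilon> > 0 \<Longrightarrow> \<exists>d>0. \<forall>n. \<forall>\<omega>\<in>space M. \<bar>X n \<omega> - c\<bar> > \<epsilon> \<longrightarrow> \<bar>Y n \<omega> - a\<bar> > d"
  shows "conv_in_prob M X c"
  by (rule conv_in_prob_le2[OF assms(1) Y Y]) (use assms in auto)

text \<open>Bounded convergence: off the event X > r/3 the integrand is at most r/3, on it at most
  \<open>K\<close>, and its probability vanishes.\<close>

lemma conv_in_prob_bounded_expectation:
  assumes "prob_space M" and X: "conv_in_prob M X 0" and [measurable]: "\<And>n. X n \<in> borel_measurable M"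
    and bd: "\<And>n \<omega>. \<omega> \<in> space M \<Longrightarrow> 0 \<le> X n \<omega> \<and> X n \<omega> \<le> K"
  shows "(\<lambda>n. \<integral>\<omega>. X n \<omega> \<partial>M) \<longlonglongrightarrow> 0"
proof (rule LIMSEQ_I)
  interpret prob_space M by fact
  fix r :: real assume r: "r > 0"
  have K0: "0 \<le> K" using bd not_empty by (metis all_not_in_conv order_trans)
  have "(\<lambda>n. K * prob {\<omega> \<in> space M. \<bar>X n \<omega> - 0\<bar> > r / 3}) \<longlonglongrightarrow> K * 0"
    using X[unfolded conv_in_prob_def, rule_format, of "r / 3"] r by (intro tendsto_mult tendsto_const) simp
  from LIMSEQ_D[OF this, of "r / 3"] r obtain N where N: "\<And>n. n \<ge> N \<Longrightarrow> K * prob {\<omega> \<in> space M. \<bar>X n \<omega> - 0\<bar> > r / 3} < r / 3"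
    using K0 by auto
  have "norm ((\<integral>\<omega>. X n \<omega> \<partial>M) - 0) < r" if "n \<ge> N" for n
  proof -
    let ?B = "{\<omega> \<in> space M. \<bar>X n \<omega> - 0\<bar> > r / 3}"
    have "(\<integral>\<omega>. X n \<omega> \<partial>M) \<le> (\<integral>\<omega>. r / 3 + K * indicator ?B \<omega> \<partial>M)"
    proof (rule integral_mono)
      show "integrable M (X n)"
        using bd by (intro integrable_const_bound[where B = K]) auto
      show "X n \<omega> \<le> r / 3 + K * indicator ?B \<omega>" if "\<omega> \<in> space M" for \<omega>
        using bd[OF that, of n] that r by (auto simp: indicator_def)
    qed (auto intro!: integrable_real_mult_indicator)
    also have "\<dots> = r / 3 + K * prob ?B"
    proof -
      have "?B \<in> sets M" by measurable
      then have "integrable M (\<lambda>\<omega>. K * indicator ?B \<omega> :: real)" "(\<integral>\<omega>. indicator ?B \<omega> \<partial>M) = prob ?B"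
        by (auto intro!: integrable_mult_right integrable_real_indicator simp: emeasure_eq_measure)
      then show ?thesis by (subst Bochner_Integration.integral_add) (simp_all add: prob_space)
    qed
    finally have "(\<integral>\<omega>. X n \<omega> \<partial>M) < r" using N[OF that] r by simp
    moreover have "0 \<le> (\<integral>\<omega>. X n \<omega> \<partial>M)" using bd by (intro integral_nonneg_AE) auto
    ultimately show ?thesis by simp
  qed
  then show "\<exists>no. \<forall>n\<ge>no. norm ((\<integral>\<omega>. X n \<omega> \<partial>M) - 0) < r" by blast
qed

text \<open>The level \<open>m\<close> is fixed through \<open>r\<close> first, and \<open>n\<close>
  grows afterwards; \<open>p m\<close> may converge at a rate that depends on
  \<open>m\<close>.\<close>

lemma tendsto_zero_two_scale:
  fixes x :: "nat \<Rightarrow> real"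
  assumes bd: "\<And>n m. \<bar>x n\<bar> \<le> p m n + r m" and p: "\<And>m. p m \<longlonglongrightarrow> 0" and r: "r \<longlonglongrightarrow> (0::real)"
  shows "x \<longlonglongrightarrow> 0"
proof (rule LIMSEQ_I)
  fix \<epsilon> :: real assume \<epsilon>: "\<epsilon> > 0"
  then obtain m where m: "\<bar>r m\<bar> < \<epsilon> / 2" using LIMSEQ_D[OF r, of "\<epsilon> / 2"] by auto
  obtain N where N: "\<And>n. n \<ge> N \<Longrightarrow> \<bar>p m n\<bar> < \<epsilon> / 2" using LIMSEQ_D[OF p, of "\<epsilon> / 2" m] \<epsilon> by auto
  have "\<bar>x n\<bar> < \<epsilon>" if "n \<ge> N" for n using bd[of n m] m N[OF that] by linarith
  then show "\<exists>no. \<forall>n\<ge>no. norm (x n - 0) < \<epsilon>" by auto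
qed

text \<open>The characteristic functions of \<open>X n\<close> and \<open>Y n\<close> at u differ by
  at most the expectation of |exp (i u (Y - X)) - 1|, a bounded variable that tends to 0 in
  probability.\<close>

lemma slutsky_diff:
  assumes "prob_space M" and [measurable]: "\<And>n. X n \<in> borel_measurable M" "\<And>n. Y n \<in> borel_measurable M"
    and N: "real_distribution N" and X: "weak_conv_m (\<lambda>n. distr M borel (X n)) N"
    and diff: "conv_in_prob M (\<lambda>n \<omega>. Y n \<omega> - X n \<omega>) 0"
  shows "weak_conv_m (\<lambda>n. distr M borel (Y n)) N"
proof (rule levy_continuity[OF _ N])
  interpret prob_space M by fact
  show "real_distribution (distr M borel (Y n))" for n by (rule real_distribution_distr) simp
  fix u
  have char: "char (distr M borel Z) u = (\<integral>\<omega>. iexp (u * Z \<omega>) \<partial>M)" if [measurable]: "Z \<in> borel_measurable M" for Z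
    unfolding char_def by (subst integral_distr) auto
  have int: "integrable M (\<lambda>\<omega>. iexp (u * Z \<omega>))" if [measurable]: "Z \<in> borel_measurable M" for Z
    by (rule integrable_const_bound[where B = 1]) auto
  \<comment> \<open>The cap 2 is the trivial bound for a difference of two numbers of modulus 1; it
    makes bounded convergence applicable.\<close>
  define g where "g n \<omega> = min 2 (\<bar>u\<bar> * \<bar>Y n \<omega> - X n \<omega>\<bar>)" for n \<omega>
  have [measurable]: "g n \<in> borel_measurable M" for n unfolding g_def by measurable
  have g_lim: "(\<lambda>n. \<integral>\<omega>. g n \<omega> \<partial>M) \<longlonglongrightarrow> 0"
  proof (rule conv_in_prob_bounded_expectation[where K = 2])
    show "conv_in_prob M g 0"
    proof (rule conv_in_prob_le[OF assms(1) diff])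
      fix \<epsilon> :: real assume \<epsilon>: "\<epsilon> > 0"
      \<comment> \<open>Dividing by \<open>\<bar>u\<bar> + 1\<close> instead of
        \<open>\<bar>u\<bar>\<close> covers u = 0.\<close>
      have "\<bar>Y n \<omega> - X n \<omega> - 0\<bar> > \<epsilon> / (\<bar>u\<bar> + 1)" if "\<bar>g n \<omega> - 0\<bar> > \<epsilon>" for n \<omega>
      proof -
        have "\<epsilon> < \<bar>u\<bar> * \<bar>Y n \<omega> - X n \<omega>\<bar>" using that \<epsilon> by (auto simp: g_def min_def split: if_splits)
        also have "\<dots> \<le> (\<bar>u\<bar> + 1) * \<bar>Y n \<omega> - X n \<omega>\<bar>" by (intro mult_right_mono) auto
        finally show ?thesis by (simp add: field_simps)
      qed
      then show "\<exists>d>0. \<forall>n. \<forall>\<omega>\<in>space M. \<bar>g n \<omega> - 0\<bar> > \<epsilon> \<longrightarrow> \<bar>Y n \<omega> - X n \<omega> - 0\<bar> > d"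
        using \<epsilon> by (intro exI[of _ "\<epsilon> / (\<bar>u\<bar> + 1)"]) auto
    qed measurable
  qed (use assms(1) in \<open>auto simp: g_def\<close>)
  have "cmod (char (distr M borel (Y n)) u - char (distr M borel (X n)) u) \<le> (\<integral>\<omega>. g n \<omega> \<partial>M)" for n
  proof -
    have "char (distr M borel (Y n)) u - char (distr M borel (X n)) u
      = (\<integral>\<omega>. iexp (u * Y n \<omega>) - iexp (u * X n \<omega>) \<partial>M)"
      using int by (simp add: char)
    also have "cmod \<dots> \<le> (\<integral>\<omega>. g n \<omega> \<partial>M)"
    proof (rule norm_integral_le)
      show "integrable M (g n)" by (rule integrable_const_bound[where B = 2]) (auto simp: g_def)
      fix \<omega>
      have "cmod (iexp (u * Y n \<omega>) - iexp (u * X n \<omega>)) \<le> cmod (iexp (u * Y n \<omega>)) + cmod (iexp (u * X n \<omega>))"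
        by (rule norm_triangle_ineq4)
      then have 2: "cmod (iexp (u * Y n \<omega>) - iexp (u * X n \<omega>)) \<le> 2" by simp
      have "iexp (u * Y n \<omega>) - iexp (u * X n \<omega>) = iexp (u * X n \<omega>) * (iexp (u * (Y n \<omega> - X n \<omega>)) - 1)"
      proof -
        have "iexp (u * X n \<omega>) * iexp (u * (Y n \<omega> - X n \<omega>)) = iexp (u * Y n \<omega>)"
          unfolding mult_exp_exp by (simp add: algebra_simps)
        then show ?thesis by (simp only: right_diff_distrib mult_1_right)
      qed
      then have "cmod (iexp (u * Y n \<omega>) - iexp (u * X n \<omega>)) = cmod (iexp (u * (Y n \<omega> - X n \<omega>)) - 1)"
        by (simp only: norm_mult norm_exp_i_times mult_1_left)
      also have "\<dots> \<le> \<bar>u * (Y n \<omega> - X n \<omega>)\<bar>"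
        using iexp_approx1[of "u * (Y n \<omega> - X n \<omega>)" 0] by simp
      finally show "cmod (iexp (u * Y n \<omega>) - iexp (u * X n \<omega>)) \<le> g n \<omega>"
        using 2 by (simp add: g_def abs_mult)
    qed (use int in auto)
    finally show ?thesis .
  qed
  then have "(\<lambda>n. char (distr M borel (Y n)) u - char (distr M borel (X n)) u) \<longlonglongrightarrow> 0"
    by (intro Lim_null_comparison[OF always_eventually g_lim]) auto
  moreover have "(\<lambda>n. char (distr M borel (X n)) u) \<longlonglongrightarrow> char N u"
    by (rule levy_continuity1[OF _ N X]) (rule real_distribution_distr, simp)
  ultimately have "(\<lambda>n. char (distr M borel (Y n)) u - char (distr M borel (X n)) u + char (distr M borel (X n)) u) \<longlonglongrightarrow> 0 + char N u"
    by (rule tendsto_add)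
  then show "(\<lambda>n. char (distr M borel (Y n)) u) \<longlonglongrightarrow> char N u" by simp
qed

text \<open>S (C - 1) exceeds epsilon only if |S| >= m, which has probability at most 1/m^2 by the
  second moment, or if |C - 1| > epsilon/m, whose probability vanishes with n for each m.\<close>

lemma conv_in_prob_mult_tight:
  assumes "prob_space M" and [measurable]: "\<And>n. S n \<in> borel_measurable M" "\<And>n. C n \<in> borel_measurable M"
    and S2: "\<And>n. integrable M (\<lambda>\<omega>. (S n \<omega>)\<^sup>2)" "\<And>n. (\<integral>\<omega>. (S n \<omega>)\<^sup>2 \<partial>M) \<le> 1"
    and C: "conv_in_prob M C 1"
  shows "conv_in_prob M (\<lambda>n \<omega>. S n \<omega> * C n \<omega> - S n \<omega>) 0"
  unfolding conv_in_prob_def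
proof (intro allI impI)
  interpret prob_space M by fact
  fix \<epsilon> :: real assume \<epsilon>: "\<epsilon> > 0"
  let ?p = "\<lambda>m n. prob {\<omega> \<in> space M. \<bar>C n \<omega> - 1\<bar> > \<epsilon> / real (Suc m)}"
  show "(\<lambda>n. prob {\<omega> \<in> space M. \<bar>S n \<omega> * C n \<omega> - S n \<omega> - 0\<bar> > \<epsilon>}) \<longlonglongrightarrow> 0"
  proof (rule tendsto_zero_two_scale[of _ ?p "\<lambda>m. 1 / (real (Suc m))\<^sup>2"])
    fix n m
    let ?m = "real (Suc m)"
    have "prob {\<omega> \<in> space M. ?m \<le> \<bar>S n \<omega>\<bar>} \<le> prob {\<omega> \<in> space M. ?m\<^sup>2 \<le> (S n \<omega>)\<^sup>2}"
      by (intro finite_measure_mono) (auto simp: abs_le_square_iff[symmetric])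
    also have "\<dots> \<le> (\<integral>\<omega>. (S n \<omega>)\<^sup>2 \<partial>M) / ?m\<^sup>2"
      by (rule integral_Markov_inequality_measure[OF S2(1), where A = "space M"]) auto
    also have "\<dots> \<le> 1 / ?m\<^sup>2" using S2(2) by (intro divide_right_mono) auto
    finally have 1: "prob {\<omega> \<in> space M. ?m \<le> \<bar>S n \<omega>\<bar>} \<le> 1 / ?m\<^sup>2" .
    have "prob {\<omega> \<in> space M. \<bar>S n \<omega> * C n \<omega> - S n \<omega> - 0\<bar> > \<epsilon>}
      \<le> prob ({\<omega> \<in> space M. \<bar>C n \<omega> - 1\<bar> > \<epsilon> / ?m} \<union> {\<omega> \<in> space M. ?m \<le> \<bar>S n \<omega>\<bar>})"
    proof (rule finite_measure_mono)
      show "{\<omega> \<in> space M. \<bar>S n \<omega> * C n \<omega> - S n \<omega> - 0\<bar> > \<epsilon>} \<subseteq>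
        {\<omega> \<in> space M. \<bar>C n \<omega> - 1\<bar> > \<epsilon> / ?m} \<union> {\<omega> \<in> space M. ?m \<le> \<bar>S n \<omega>\<bar>}"
      proof (rule subsetI, rule ccontr)
        fix \<omega> assume a: "\<omega> \<in> {\<omega> \<in> space M. \<bar>S n \<omega> * C n \<omega> - S n \<omega> - 0\<bar> > \<epsilon>}"
          "\<omega> \<notin> {\<omega> \<in> space M. \<bar>C n \<omega> - 1\<bar> > \<epsilon> / ?m} \<union> {\<omega> \<in> space M. ?m \<le> \<bar>S n \<omega>\<bar>}"
        then have "\<bar>S n \<omega>\<bar> * \<bar>C n \<omega> - 1\<bar> \<le> ?m * (\<epsilon> / ?m)" by (intro mult_mono) auto
        also have "\<dots> = \<epsilon>" by simp
        finally have "\<bar>S n \<omega> * C n \<omega> - S n \<omega>\<bar> \<le> \<epsilon>" by (simp add: abs_mult[symmetric] right_diff_distrib)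
        then show False using a by simp
      qed
    qed measurable
    also have "\<dots> \<le> prob {\<omega> \<in> space M. \<bar>C n \<omega> - 1\<bar> > \<epsilon> / ?m} + prob {\<omega> \<in> space M. ?m \<le> \<bar>S n \<omega>\<bar>}"
      by (intro measure_Un_le) auto
    finally show "\<bar>prob {\<omega> \<in> space M. \<bar>S n \<omega> * C n \<omega> - S n \<omega> - 0\<bar> > \<epsilon>}\<bar> \<le> ?p m n + 1 / ?m\<^sup>2"
      using 1 by simp
  next
    show "(\<lambda>n. ?p m n) \<longlonglongrightarrow> 0" for m
      using C \<epsilon> unfolding conv_in_prob_def by simp
    show "(\<lambda>m. 1 / (real (Suc m))\<^sup>2) \<longlonglongrightarrow> 0"
      using tendsto_power[OF LIMSEQ_Suc[OF lim_1_over_n[where 'a = real]], of 2] by (simp add: power_divide)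
  qed
qed

lemma conv_in_prob_mult_one:
  assumes "prob_space M" and P: "conv_in_prob M P 1" and Q: "conv_in_prob M Q 1"
    and "\<And>n. P n \<in> borel_measurable M" "\<And>n. Q n \<in> borel_measurable M"
  shows "conv_in_prob M (\<lambda>n \<omega>. P n \<omega> * Q n \<omega>) 1"
proof (rule conv_in_prob_le2[OF assms])
  fix \<epsilon> :: real assume \<epsilon>: "\<epsilon> > 0"
  \<comment> \<open>\<open>d \<le> 1\<close> gives |q| <= 2, hence pq - 1 = (p - 1) q + (q - 1) is
    at most 3 d in modulus.\<close>
  define d where "d = min 1 (\<epsilon> / 3)"
  have d: "d > 0" "d \<le> 1" "3 * d \<le> \<epsilon>" using \<epsilon> by (auto simp: d_def)
  have "\<bar>p * q - 1\<bar> \<le> \<epsilon>" if "\<bar>p - 1\<bar> \<le> d" "\<bar>q - 1\<bar> \<le> d" for p q :: real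
  proof -
    have "\<bar>p * q - 1\<bar> = \<bar>(p - 1) * q + (q - 1)\<bar>" by (simp add: algebra_simps)
    also have "\<dots> \<le> \<bar>p - 1\<bar> * \<bar>q\<bar> + \<bar>q - 1\<bar>" by (metis abs_mult abs_triangle_ineq)
    also have "\<dots> \<le> d * 2 + d" using that d by (intro add_mono mult_mono) auto
    finally show ?thesis using d by simp
  qed
  then show "\<exists>d>0. \<forall>n. \<forall>\<omega>\<in>space M. \<bar>P n \<omega> * Q n \<omega> - 1\<bar> > \<epsilon> \<longrightarrow> \<bar>P n \<omega> - 1\<bar> > d \<or> \<bar>Q n \<omega> - 1\<bar> > d"
    using d by (intro exI[of _ d]) (meson not_less)
qed

lemma conv_in_prob_const_divide:
  assumes "prob_space M" and X: "conv_in_prob M X c" and c: "c > 0"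
    and "\<And>n. X n \<in> borel_measurable M"
  shows "conv_in_prob M (\<lambda>n \<omega>. c / X n \<omega>) 1"
proof (rule conv_in_prob_le[OF assms(1) X assms(4)])
  fix \<epsilon> :: real assume \<epsilon>: "\<epsilon> > 0"
  \<comment> \<open>The first entry keeps z above c/2, away from the pole; the second then makes the
    quotient at most epsilon.\<close>
  define d where "d = c * min (1/2) (\<epsilon> / 2)"
  have d: "d > 0" "d \<le> c / 2" "d \<le> c * (\<epsilon> / 2)"
    using \<epsilon> c by (auto simp: d_def)
  have "\<bar>c / z - 1\<bar> \<le> \<epsilon>" if "\<bar>z - c\<bar> \<le> d" for z
  proof -
    have z: "c / 2 \<le> z" using that d(2) by linarith
    then have z0: "0 < z" using c by linarith
    have "\<bar>c / z - 1\<bar> = \<bar>z - c\<bar> / z"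
    proof -
      have "c / z - 1 = (c - z) / z" using z0 by (simp add: field_simps)
      then show ?thesis using z0 by (simp add: abs_minus_commute)
    qed
    also have "\<dots> \<le> (c * (\<epsilon> / 2)) / (c / 2)"
      using that d z c \<epsilon> by (intro frac_le) auto
    finally show ?thesis using c by simp
  qed
  then show "\<exists>d>0. \<forall>n. \<forall>\<omega>\<in>space M. \<bar>c / X n \<omega> - 1\<bar> > \<epsilon> \<longrightarrow> \<bar>X n \<omega> - c\<bar> > d"
    using d by (intro exI[of _ d]) (meson not_less)
qed

section \<open>Predictably weighted sums of martingale differences\<close>

lemma exp_minus_approx:
  fixes x :: real
  assumes "x \<ge> 0"
  shows "\<bar>exp (- x) - (1 - x)\<bar> \<le> x\<^sup>2 / 2"
proof -
  have "1 - x \<le> exp (- x)" using exp_ge_add_one_self[of "- x"] by simp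
  moreover have "exp (- x) \<le> 1 - x + x\<^sup>2 / 2"
  proof (cases "x = 0")
    case False
    \<comment> \<open>The difference of the two sides vanishes at 0, and its derivative -1 + t + exp
      (-t) is nonnegative.\<close>
    have "\<exists>t. 0 < t \<and> t < x \<and> (1 - x + x\<^sup>2 / 2 - exp (- x)) - (1 - 0 + 0\<^sup>2 / 2 - exp (- 0)) = (x - 0) * (- 1 + t + exp (- t))"
      using assms False
      by (intro MVT2[of 0 x "\<lambda>x. 1 - x + x\<^sup>2 / 2 - exp (- x)"]) (auto intro!: derivative_eq_intros)
    then obtain t where t: "1 - x + x\<^sup>2 / 2 - exp (- x) = x * (- 1 + t + exp (- t))" by auto
    have "0 \<le> - 1 + t + exp (- t)" using exp_ge_add_one_self[of "- t"] by simp
    then show ?thesis using t assms by (smt (verit) mult_nonneg_nonneg)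
  qed simp
  ultimately show ?thesis by simp
qed

text \<open>Combines the remainders 2 x^2/2! and |x|^3/3!. The quadratic branch is integrable under
  two moments; the cubic branch supplies smallness.\<close>

lemma iexp_approx_quadratic:
  "cmod (iexp x - (1 + \<i> * x - x\<^sup>2 / 2)) \<le> x\<^sup>2 * min 1 \<bar>x\<bar>"
proof -
  have eq: "(\<Sum>k\<le>2. (\<i> * complex_of_real x)^k / fact k) = 1 + \<i> * x - x\<^sup>2 / 2"
    by (simp add: numeral_2_eq_2 power2_eq_square mult_ac)
  have "cmod (iexp x - (1 + \<i> * x - x\<^sup>2 / 2)) \<le> x\<^sup>2"
    using iexp_approx2[of x 2] unfolding eq by simp
  moreover have "cmod (iexp x - (1 + \<i> * x - x\<^sup>2 / 2)) \<le> \<bar>x\<bar> ^ 3 / 6"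
    using iexp_approx1[of x 2] unfolding eq by (simp add: eval_nat_numeral)
  moreover have "\<bar>x\<bar> ^ 3 / 6 \<le> x\<^sup>2 * \<bar>x\<bar>"
  proof -
    have "x\<^sup>2 * \<bar>x\<bar> = \<bar>x\<bar> ^ 3" by (simp add: power3_eq_cube power2_eq_square)
    then show ?thesis by simp
  qed
  ultimately show ?thesis by (simp add: min_def)
qed

lemma min_1_mult_le: "min 1 (a * b) \<le> (1 + a) * min 1 b" if "a \<ge> 0" "b \<ge> 0" for a b :: real
  using that mult_nonneg_nonneg[OF that] by (auto simp: min_def algebra_simps)

text \<open>For |y| <= m the cubic branch gives at most m^3/m^4; for |y| > m one may multiply y^2 by
  (|y|/m)^delta >= 1. The power 4 is what leaves 1/m in the first case; \<open>1 / m ^ 4\<close> is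
  later the threshold that separates small weights from large ones.\<close>

lemma truncation_pointwise:
  fixes y m \<delta> :: real
  assumes "m \<ge> 1" "\<delta> > 0"
  shows "y\<^sup>2 * min 1 (\<bar>y\<bar> / m ^ 4) \<le> 1 / m + m powr (- \<delta>) * \<bar>y\<bar> powr (2 + \<delta>)"
proof (cases "\<bar>y\<bar> \<le> m")
  case True
  have "y\<^sup>2 * min 1 (\<bar>y\<bar> / m ^ 4) \<le> y\<^sup>2 * (\<bar>y\<bar> / m ^ 4)" by (intro mult_left_mono) auto
  also have "\<dots> = \<bar>y\<bar> ^ 3 / m ^ 4" by (simp add: power3_eq_cube power2_eq_square)
  also have "\<dots> \<le> m ^ 3 / m ^ 4" using True assms by (intro divide_right_mono power_mono) auto
  also have "\<dots> = 1 / m" using assms by (simp add: eval_nat_numeral)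
  finally show ?thesis by (rule order_trans) simp
next
  case False
  then have y: "0 < \<bar>y\<bar>" using assms by simp
  have "y\<^sup>2 * min 1 (\<bar>y\<bar> / m ^ 4) \<le> y\<^sup>2 * 1" by (intro mult_left_mono) auto
  also have "\<dots> \<le> y\<^sup>2 * (\<bar>y\<bar> / m) powr \<delta>"
    using False assms by (intro mult_left_mono ge_one_powr_ge_zero) auto
  also have "\<dots> = m powr (- \<delta>) * \<bar>y\<bar> powr (2 + \<delta>)"
    using y assms by (simp add: powr_divide powr_add powr_minus field_simps)
  finally show ?thesis using assms by (simp add: add_increasing)
qed

section \<open>From real to extended nonnegative conditional expectations\<close>

text \<open>For nonnegative \<open>X\<close> the negative part drops out of
  \<open>real_cond_exp\<close>, and since \<open>enn2real\<close> sends infinity to 0, a positive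
  value \<open>c\<close> can only come from \<open>ennreal c\<close>.\<close>

lemma (in sigma_finite_subalgebra) nn_cond_exp_eq_of_real_cond_exp_eq:
  assumes "\<And>\<omega>. 0 \<le> X \<omega>" "c > 0" and "AE \<omega> in M. real_cond_exp M F X \<omega> = c"
  shows "AE \<omega> in M. nn_cond_exp M F (\<lambda>\<omega>. ennreal (X \<omega>)) \<omega> = ennreal c"
proof -
  have "AE \<omega> in M. 0 = nn_cond_exp M F (\<lambda>\<omega>. 0) \<omega>"
    by (rule nn_cond_exp_F_meas) simp
  with assms(3) show ?thesis
  proof eventually_elim
    case (elim \<omega>)
    then have "enn2real (nn_cond_exp M F (\<lambda>\<omega>. ennreal (X \<omega>)) \<omega>) = c"
      using assms(1) by (simp add: real_cond_exp_def ennreal_neg)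
    then show ?case using assms(2)
      by (metis ennreal_enn2real enn2real_top less_irrefl top.not_eq_extremum)
  qed
qed

text \<open>Where the conditional expectation of a nonnegative function is infinite, \<^const>\<open>real_cond_exp\<close>
  has the junk value 0; a positive value therefore forces integrability.\<close>
lemma (in finite_measure_subalgebra) integrable_of_real_cond_exp_eq:
  assumes [measurable]: "X \<in> borel_measurable M"
    and "\<And>\<omega>. 0 \<le> X \<omega>" "c > 0" and "AE \<omega> in M. real_cond_exp M F X \<omega> = c"
  shows "integrable M X"
proof (rule integrableI_bounded)
  have "(\<integral>\<^sup>+\<omega>. ennreal (X \<omega>) \<partial>M) = (\<integral>\<^sup>+\<omega>. nn_cond_exp M F (\<lambda>\<omega>. ennreal (X \<omega>)) \<omega> \<partial>M)"
    using nn_cond_exp_intg[of "\<lambda>_. 1" "\<lambda>\<omega>. ennreal (X \<omega>)"] by simp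
  also have "\<dots> = (\<integral>\<^sup>+\<omega>. ennreal c \<partial>M)"
    by (rule nn_integral_cong_AE[OF nn_cond_exp_eq_of_real_cond_exp_eq[OF assms(2-4)]])
  also have "\<dots> < \<infinity>" by (simp add: emeasure_eq_measure ennreal_mult_less_top)
  finally show "(\<integral>\<^sup>+\<omega>. ennreal (norm (X \<omega>)) \<partial>M) < \<infinity>" using assms(2) by simp
qed simp

lemma integrable_bounded_mult:
  fixes H :: "'a \<Rightarrow> complex"
  assumes [measurable]: "H \<in> borel_measurable M" and "\<And>\<omega>. \<omega> \<in> space M \<Longrightarrow> cmod (H \<omega>) \<le> K"
    and g: "integrable M g"
  shows "integrable M (\<lambda>\<omega>. H \<omega> * complex_of_real (g \<omega>))"
proof (rule Bochner_Integration.integrable_bound)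
  show "integrable M (\<lambda>\<omega>. K * g \<omega>)" using g by simp
  have [measurable]: "g \<in> borel_measurable M" using g by simp
  show "(\<lambda>\<omega>. H \<omega> * complex_of_real (g \<omega>)) \<in> borel_measurable M" by measurable
  show "AE \<omega> in M. cmod (H \<omega> * complex_of_real (g \<omega>)) \<le> norm (K * g \<omega>)"
  proof (rule AE_I2)
    fix \<omega> assume "\<omega> \<in> space M"
    from assms(2)[OF this] have "cmod (H \<omega>) \<le> \<bar>K\<bar>" by linarith
    then show "cmod (H \<omega> * complex_of_real (g \<omega>)) \<le> norm (K * g \<omega>)"
      by (simp add: norm_mult abs_mult mult_right_mono)
  qed
qed

section \<open>Noise with unit conditional variance\<close>

text \<open>The noise is divided by sigma, so that weights with squares summing to 1 give a standard
  normal limit. The moment condition is an extended-valued supremum that is finite almost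
  everywhere, so its size may depend on the path.\<close>

locale unit_noise = prob_space M for M :: "'a measure" +
  fixes F :: "nat \<Rightarrow> 'a measure" and e :: "nat \<Rightarrow> 'a \<Rightarrow> real" and \<delta> :: real
  assumes \<delta>_pos: "\<delta> > 0"
    and subalg: "\<And>t. subalgebra M (F t)"
    and F_mono: "\<And>s t. s \<le> t \<Longrightarrow> subalgebra (F t) (F s)"
    and e_adapted: "\<And>t. t \<ge> 1 \<Longrightarrow> e t \<in> borel_measurable (F t)"
    and e_mean: "\<And>t. t \<ge> 1 \<Longrightarrow> AE \<omega> in M. real_cond_exp M (F (t - 1)) (e t) \<omega> = 0"
    and e_var: "\<And>t. t \<ge> 1 \<Longrightarrow> AE \<omega> in M. real_cond_exp M (F (t - 1)) (\<lambda>\<omega>. (e t \<omega>)\<^sup>2) \<omega> = 1"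
    and e_moment: "AE \<omega> in M. (SUP t\<in>{1..}. nn_cond_exp M (F (t - 1))
      (\<lambda>\<omega>. ennreal (\<bar>e t \<omega>\<bar> powr (2 + \<delta>))) \<omega>) < \<infinity>"
begin

lemma sigma_finite_subalgebra_F: "sigma_finite_subalgebra M (F t)"
  using subalg finite_measure_axioms
  by (intro finite_measure_subalgebra_is_sigma_finite finite_measure_subalgebra.intro
      finite_measure_subalgebra_axioms.intro)

lemma measurable_F_M: "f \<in> borel_measurable (F t) \<Longrightarrow> f \<in> borel_measurable M"
  using measurable_from_subalg subalg by blast

lemma measurable_F_mono: "s \<le> t \<Longrightarrow> f \<in> borel_measurable (F s) \<Longrightarrow> f \<in> borel_measurable (F t)"
  using measurable_from_subalg F_mono by blast

lemma e_measurable [measurable]: "t \<ge> 1 \<Longrightarrow> e t \<in> borel_measurable M"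
  using e_adapted measurable_F_M by blast

lemma nn_cond_exp_e_sq:
  assumes "t \<ge> 1"
  shows "AE \<omega> in M. nn_cond_exp M (F (t - 1)) (\<lambda>\<omega>. ennreal ((e t \<omega>)\<^sup>2)) \<omega> = 1"
proof -
  interpret sigma_finite_subalgebra M "F (t - 1)" by (rule sigma_finite_subalgebra_F)
  show ?thesis
    using nn_cond_exp_eq_of_real_cond_exp_eq[OF _ _ e_var[OF assms]] by simp
qed

text \<open>Stated for nonnegative integrals so that it applies before any integrability is known;
  \<open>h\<close> = 1 then yields \<open>integrable_e_sq\<close>.\<close>

lemma nn_integral_mult_e_sq:
  assumes t: "t \<ge> 1" and h: "h \<in> borel_measurable (F (t - 1))"
  shows "(\<integral>\<^sup>+\<omega>. h \<omega> * ennreal ((e t \<omega>)\<^sup>2) \<partial>M) = (\<integral>\<^sup>+\<omega>. h \<omega> \<partial>M)"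
proof -
  interpret sigma_finite_subalgebra M "F (t - 1)" by (rule sigma_finite_subalgebra_F)
  note [measurable] = e_measurable[OF t]
  have "(\<integral>\<^sup>+\<omega>. h \<omega> * ennreal ((e t \<omega>)\<^sup>2) \<partial>M)
      = (\<integral>\<^sup>+\<omega>. h \<omega> * nn_cond_exp M (F (t - 1)) (\<lambda>\<omega>. ennreal ((e t \<omega>)\<^sup>2)) \<omega> \<partial>M)"
    by (rule nn_cond_exp_intg[symmetric, OF h]) measurable
  also have "\<dots> = (\<integral>\<^sup>+\<omega>. h \<omega> \<partial>M)"
    using nn_cond_exp_e_sq[OF t] by (intro nn_integral_cong_AE) auto
  finally show ?thesis .
qed

lemma integrable_e_sq: "t \<ge> 1 \<Longrightarrow> integrable M (\<lambda>\<omega>. (e t \<omega>)\<^sup>2)"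
  using nn_integral_mult_e_sq[of t "\<lambda>_. 1"]
  by (intro integrableI_bounded) (auto simp: emeasure_space_1)

lemma integrable_e: "t \<ge> 1 \<Longrightarrow> integrable M (e t)"
  using square_integrable_imp_integrable[OF e_measurable integrable_e_sq] by blast

text \<open>\<open>real_cond_exp\<close> is real-valued, while the predictable factors of the
  characteristic function are complex; the real and imaginary parts are treated separately.\<close>

lemma integral_mult_cond_exp_const:
  fixes H :: "'a \<Rightarrow> complex"
  assumes H: "H \<in> borel_measurable (F s)" and K: "\<And>\<omega>. \<omega> \<in> space M \<Longrightarrow> cmod (H \<omega>) \<le> K"
    and g: "integrable M g" and c: "AE \<omega> in M. real_cond_exp M (F s) g \<omega> = c"
  shows "(\<integral>\<omega>. H \<omega> * complex_of_real (g \<omega>) \<partial>M) = (\<integral>\<omega>. H \<omega> \<partial>M) * complex_of_real c"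
proof -
  interpret sigma_finite_subalgebra M "F s" by (rule sigma_finite_subalgebra_F)
  note [measurable] = H measurable_F_M[OF H]
  have g_meas[measurable]: "g \<in> borel_measurable M" using g by simp
  have int: "integrable M (\<lambda>\<omega>. H \<omega> * complex_of_real (g \<omega>))"
    by (rule integrable_bounded_mult[OF _ K g]) measurable
  have intH: "integrable M H"
    using integrable_bounded_mult[OF measurable_F_M[OF H] K, of "\<lambda>_. 1"] by simp
  have real: "(\<integral>\<omega>. h \<omega> * g \<omega> \<partial>M) = (\<integral>\<omega>. h \<omega> \<partial>M) * c"
    if h: "h \<in> borel_measurable (F s)" "integrable M (\<lambda>\<omega>. h \<omega> * g \<omega>)" for h
  proof -
    note [measurable] = h(1) measurable_F_M[OF h(1)]
    have "(\<integral>\<omega>. h \<omega> * g \<omega> \<partial>M) = (\<integral>\<omega>. h \<omega> * real_cond_exp M (F s) g \<omega> \<partial>M)"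
      using real_cond_exp_intg(2)[OF h(2,1) g_meas] by simp
    also have "\<dots> = (\<integral>\<omega>. h \<omega> * c \<partial>M)"
      using c by (intro integral_cong_AE) auto
    finally show ?thesis by simp
  qed
  show ?thesis
  proof (rule complex_eqI)
    have "integrable M (\<lambda>\<omega>. Re (H \<omega> * complex_of_real (g \<omega>)))" using int by (rule integrable_Re)
    then show "Re (\<integral>\<omega>. H \<omega> * complex_of_real (g \<omega>) \<partial>M) = Re ((\<integral>\<omega>. H \<omega> \<partial>M) * complex_of_real c)"
      using real[of "\<lambda>\<omega>. Re (H \<omega>)"] int intH by (simp flip: integral_Re)
    have "integrable M (\<lambda>\<omega>. Im (H \<omega> * complex_of_real (g \<omega>)))" using int by (rule integrable_Im)
    then show "Im (\<integral>\<omega>. H \<omega> * complex_of_real (g \<omega>) \<partial>M) = Im ((\<integral>\<omega>. H \<omega> \<partial>M) * complex_of_real c)"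
      using real[of "\<lambda>\<omega>. Im (H \<omega>)"] int intH by (simp flip: integral_Im)
  qed
qed


text \<open>The first- and second-order terms of the expansion of \<open>iexp\<close> cancel because \<open>A\<close> and \<open>w\<close> are
  predictable; only the Taylor remainders survive.\<close>
lemma char_step:
  fixes A :: "'a \<Rightarrow> complex"
  assumes t: "t \<ge> 1" and A: "A \<in> borel_measurable (F (t - 1))"
    and K: "\<And>\<omega>. \<omega> \<in> space M \<Longrightarrow> cmod (A \<omega>) \<le> K"
    and w: "w \<in> borel_measurable (F (t - 1))" and w1: "\<And>\<omega>. \<omega> \<in> space M \<Longrightarrow> \<bar>w \<omega>\<bar> \<le> 1"
  shows "cmod (\<integral>\<omega>. A \<omega> * (iexp (u * (w \<omega> * e t \<omega>)) - complex_of_real (exp (- ((u * w \<omega>)\<^sup>2 / 2)))) \<partial>M)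
    \<le> K * ((\<integral>\<omega>. (u * (w \<omega> * e t \<omega>))\<^sup>2 * min 1 \<bar>u * (w \<omega> * e t \<omega>)\<bar> \<partial>M) + (\<integral>\<omega>. (u * w \<omega>) ^ 4 / 8 \<partial>M))"
proof -
  note [measurable] = A w measurable_F_M[OF A] measurable_F_M[OF w] e_measurable[OF t]
  define a where "a \<omega> = u * (w \<omega> * e t \<omega>)" for \<omega>
  define b where "b \<omega> = (u * w \<omega>)\<^sup>2 / 2" for \<omega>
  define r where "r \<omega> = iexp (a \<omega>) - (1 + \<i> * a \<omega> - (a \<omega>)\<^sup>2 / 2)" for \<omega>
  define q where "q \<omega> = 1 - b \<omega> - exp (- b \<omega>)" for \<omega>
  have [measurable]: "a \<in> borel_measurable M" "b \<in> borel_measurable M" "r \<in> borel_measurable M" "q \<in> borel_measurable M"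
    unfolding a_def b_def r_def q_def by measurable
  have uw: "\<bar>u * w \<omega>\<bar> \<le> \<bar>u\<bar>" if "\<omega> \<in> space M" for \<omega>
    using w1[OF that] by (simp add: abs_mult mult_left_le)
  have b_bd: "0 \<le> b \<omega> \<and> b \<omega> \<le> u\<^sup>2 / 2" if "\<omega> \<in> space M" for \<omega>
    using uw[OF that] unfolding b_def by (simp add: abs_le_square_iff)
  have uw4: "(u * w \<omega>) ^ 4 / 8 = (b \<omega>)\<^sup>2 / 2" for \<omega>
    by (simp add: b_def power_divide power2_eq_square eval_nat_numeral)
  have q_bd: "\<bar>q \<omega>\<bar> \<le> (u * w \<omega>) ^ 4 / 8" if "\<omega> \<in> space M" for \<omega>
    using exp_minus_approx[of "b \<omega>"] b_bd[OF that] unfolding uw4 q_def by (simp add: abs_minus_commute)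
  have r_bd: "cmod (r \<omega>) \<le> (a \<omega>)\<^sup>2 * min 1 \<bar>a \<omega>\<bar>" for \<omega>
    unfolding r_def by (rule iexp_approx_quadratic)
  have K0: "0 \<le> K" using K not_empty by (metis all_not_in_conv norm_ge_zero order_trans)
  have int_a2: "integrable M (\<lambda>\<omega>. (a \<omega>)\<^sup>2)"
  proof (rule Bochner_Integration.integrable_bound)
    show "integrable M (\<lambda>\<omega>. u\<^sup>2 * (e t \<omega>)\<^sup>2)" using integrable_e_sq[OF t] by simp
    show "AE \<omega> in M. norm ((a \<omega>)\<^sup>2) \<le> norm (u\<^sup>2 * (e t \<omega>)\<^sup>2)"
    proof (rule AE_I2)
      fix \<omega> assume "\<omega> \<in> space M"
      then have "(u * w \<omega>)\<^sup>2 \<le> u\<^sup>2" using uw by (simp add: abs_le_square_iff)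
      then show "norm ((a \<omega>)\<^sup>2) \<le> norm (u\<^sup>2 * (e t \<omega>)\<^sup>2)"
        by (simp add: a_def power_mult_distrib mult_right_mono flip: mult.assoc)
    qed
  qed measurable
  have int_m: "integrable M (\<lambda>\<omega>. (a \<omega>)\<^sup>2 * min 1 \<bar>a \<omega>\<bar>)"
    by (rule Bochner_Integration.integrable_bound[OF int_a2]) (auto simp: abs_mult mult_left_le)
  have int_w4: "integrable M (\<lambda>\<omega>. (u * w \<omega>) ^ 4 / 8)"
  proof (rule integrable_const_bound[where B = "u ^ 4 / 8"])
    show "AE \<omega> in M. norm ((u * w \<omega>) ^ 4 / 8) \<le> u ^ 4 / 8"
    proof (rule AE_I2)
      fix \<omega> assume "\<omega> \<in> space M"
      from power_mono[OF uw[OF this], of 4] show "norm ((u * w \<omega>) ^ 4 / 8) \<le> u ^ 4 / 8"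
        by (simp add: power_even_abs)
    qed
  qed measurable
  have int_Ar: "integrable M (\<lambda>\<omega>. A \<omega> * r \<omega>)"
  proof (rule Bochner_Integration.integrable_bound)
    show "integrable M (\<lambda>\<omega>. K * ((a \<omega>)\<^sup>2 * min 1 \<bar>a \<omega>\<bar>))" using int_m by simp
    show "AE \<omega> in M. norm (A \<omega> * r \<omega>) \<le> norm (K * ((a \<omega>)\<^sup>2 * min 1 \<bar>a \<omega>\<bar>))"
      using K r_bd K0 by (intro AE_I2) (auto simp: norm_mult abs_mult intro!: mult_mono)
  qed measurable
  have int_Aq: "integrable M (\<lambda>\<omega>. A \<omega> * complex_of_real (q \<omega>))"
  proof (rule integrable_bounded_mult[OF _ K])
    show "integrable M q"
      by (rule Bochner_Integration.integrable_bound[OF int_w4]) (use q_bd in auto)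
  qed measurable
  have Ab: "cmod (A \<omega> * complex_of_real (b \<omega>)) \<le> K * (u\<^sup>2 / 2)" if "\<omega> \<in> space M" for \<omega>
    unfolding norm_mult using K[OF that] b_bd[OF that] K0 by (intro mult_mono) auto
  have Au: "cmod (A \<omega> * \<i> * complex_of_real (u * w \<omega>)) \<le> K * \<bar>u\<bar>" if "\<omega> \<in> space M" for \<omega>
    using K[OF that] uw[OF that] K0 by (auto simp: norm_mult abs_mult intro!: mult_mono)
  have mAb: "(\<lambda>\<omega>. A \<omega> * complex_of_real (b \<omega>)) \<in> borel_measurable (F (t - 1))"
    and mAu: "(\<lambda>\<omega>. A \<omega> * \<i> * complex_of_real (u * w \<omega>)) \<in> borel_measurable (F (t - 1))"
    unfolding b_def by measurable
  have i1: "integrable M (\<lambda>\<omega>. A \<omega> * \<i> * complex_of_real (u * w \<omega>) * complex_of_real (e t \<omega>))"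
    by (rule integrable_bounded_mult[OF measurable_F_M[OF mAu] Au integrable_e[OF t]])
  have i2: "integrable M (\<lambda>\<omega>. A \<omega> * complex_of_real (b \<omega>) * complex_of_real ((e t \<omega>)\<^sup>2))"
    by (rule integrable_bounded_mult[OF measurable_F_M[OF mAb] Ab integrable_e_sq[OF t]])
  have i3: "integrable M (\<lambda>\<omega>. A \<omega> * complex_of_real (b \<omega>))"
    using integrable_bounded_mult[OF measurable_F_M[OF mAb] Ab, of "\<lambda>_. 1"] by simp
  have zero: "(\<integral>\<omega>. A \<omega> * \<i> * complex_of_real (u * w \<omega>) * complex_of_real (e t \<omega>) \<partial>M) = 0"
    using integral_mult_cond_exp_const[OF mAu Au integrable_e[OF t] e_mean[OF t]] by simp
  have one: "(\<integral>\<omega>. A \<omega> * complex_of_real (b \<omega>) * complex_of_real ((e t \<omega>)\<^sup>2) \<partial>M) = (\<integral>\<omega>. A \<omega> * complex_of_real (b \<omega>) \<partial>M)"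
    using integral_mult_cond_exp_const[OF mAb Ab integrable_e_sq[OF t] e_var[OF t]] by simp
  \<comment> \<open>Both exponentials are replaced by expansion plus remainder. As (a)^2/2 equals b
    e^2 and e^2 has conditional mean 1, the last two terms integrate to 0 together; the linear term
    does so by the zero conditional mean.\<close>
  have "A \<omega> * (iexp (a \<omega>) - complex_of_real (exp (- b \<omega>))) =
    A \<omega> * r \<omega> + A \<omega> * complex_of_real (q \<omega>) + A \<omega> * \<i> * complex_of_real (u * w \<omega>) * complex_of_real (e t \<omega>)
     - A \<omega> * complex_of_real (b \<omega>) * complex_of_real ((e t \<omega>)\<^sup>2) + A \<omega> * complex_of_real (b \<omega>)" for \<omega>
  proof -
    have "(a \<omega>)\<^sup>2 / 2 = b \<omega> * (e t \<omega>)\<^sup>2" by (simp add: a_def b_def power_mult_distrib)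
    then have "complex_of_real (b \<omega>) * complex_of_real ((e t \<omega>)\<^sup>2) = complex_of_real ((a \<omega>)\<^sup>2) / 2"
      by (metis of_real_divide of_real_mult of_real_numeral)
    then show ?thesis
      by (simp add: r_def q_def a_def[of \<omega>] algebra_simps)
  qed
  then have "(\<integral>\<omega>. A \<omega> * (iexp (a \<omega>) - complex_of_real (exp (- b \<omega>))) \<partial>M)
    = (\<integral>\<omega>. A \<omega> * r \<omega> \<partial>M) + (\<integral>\<omega>. A \<omega> * complex_of_real (q \<omega>) \<partial>M)"
    using int_Ar int_Aq i1 i2 i3 zero one by simp
  also have "cmod \<dots> \<le> (\<integral>\<omega>. K * ((a \<omega>)\<^sup>2 * min 1 \<bar>a \<omega>\<bar>) \<partial>M) + (\<integral>\<omega>. K * ((u * w \<omega>) ^ 4 / 8) \<partial>M)"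
  proof (rule order_trans[OF norm_triangle_ineq add_mono])
    show "cmod (\<integral>\<omega>. A \<omega> * r \<omega> \<partial>M) \<le> (\<integral>\<omega>. K * ((a \<omega>)\<^sup>2 * min 1 \<bar>a \<omega>\<bar>) \<partial>M)"
      using int_Ar int_m K r_bd K0
      by (intro norm_integral_le) (auto simp: norm_mult intro!: mult_mono)
    show "cmod (\<integral>\<omega>. A \<omega> * complex_of_real (q \<omega>) \<partial>M) \<le> (\<integral>\<omega>. K * ((u * w \<omega>) ^ 4 / 8) \<partial>M)"
    proof (intro norm_integral_le)
      fix \<omega> assume "\<omega> \<in> space M"
      then show "cmod (A \<omega> * complex_of_real (q \<omega>)) \<le> K * ((u * w \<omega>) ^ 4 / 8)"
        unfolding norm_mult norm_of_real using K K0 q_bd by (intro mult_mono) auto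
    qed (use int_Aq integrable_mult_right[OF int_w4, of K] in auto)
  qed
  finally show ?thesis
    using int_m int_w4 by (simp add: a_def b_def distrib_left)
qed


section \<open>Truncated conditional second moments and the Lindeberg term\<close>

definition moment_sup :: "'a \<Rightarrow> ennreal" where
  "moment_sup \<omega> = (SUP t\<in>{1..}. nn_cond_exp M (F (t - 1)) (\<lambda>\<omega>. ennreal (\<bar>e t \<omega>\<bar> powr (2 + \<delta>))) \<omega>)"

text \<open>The moment bound is random and need not be integrable; capping at 1, which is the conditional
  variance, makes dominated convergence available.\<close>
definition tail_bound :: "real \<Rightarrow> 'a \<Rightarrow> real" where
  "tail_bound m \<omega> = min 1 (1 / m + m powr (- \<delta>) * enn2real (moment_sup \<omega>))"

lemma moment_sup_measurable [measurable]: "moment_sup \<in> borel_measurable M"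
  unfolding moment_sup_def by measurable

lemma tail_bound_measurable [measurable]: "tail_bound m \<in> borel_measurable M"
  unfolding tail_bound_def by measurable

lemma tail_bound_bounds: "m \<ge> 1 \<Longrightarrow> 0 \<le> tail_bound m \<omega> \<and> tail_bound m \<omega> \<le> 1"
  by (simp add: tail_bound_def)

lemma integral_tail_bound_tendsto: "(\<lambda>n. \<integral>\<omega>. tail_bound (real (Suc n)) \<omega> \<partial>M) \<longlonglongrightarrow> 0"
proof -
  have "(\<lambda>n. \<integral>\<omega>. tail_bound (real (Suc n)) \<omega> \<partial>M) \<longlonglongrightarrow> (\<integral>\<omega>. 0 \<partial>M)"
  proof (rule integral_dominated_convergence[where w = "\<lambda>_. 1"])
    show "AE \<omega> in M. (\<lambda>n. tail_bound (real (Suc n)) \<omega>) \<longlonglongrightarrow> 0"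
    proof (rule AE_I2)
      \<comment> \<open>\<open>enn2real\<close> is finite at every point, so this limit holds
        everywhere.\<close>
      fix \<omega>
      have 1: "(\<lambda>n. 1 / real (Suc n)) \<longlonglongrightarrow> 0"
        using LIMSEQ_Suc[OF lim_1_over_n[where 'a = real]] by simp
      have 2: "(\<lambda>n. real (Suc n) powr (- \<delta>)) \<longlonglongrightarrow> 0"
        using \<delta>_pos filterlim_compose[OF filterlim_real_sequentially filterlim_Suc]
        by (intro tendsto_neg_powr) auto
      have "(\<lambda>n. min 1 (1 / real (Suc n) + real (Suc n) powr (- \<delta>) * enn2real (moment_sup \<omega>)))
          \<longlonglongrightarrow> min 1 (0 + 0 * enn2real (moment_sup \<omega>))"
        by (intro tendsto_min tendsto_add tendsto_mult tendsto_const 1 2)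
      then show "(\<lambda>n. tail_bound (real (Suc n)) \<omega>) \<longlonglongrightarrow> 0"
        by (simp add: tail_bound_def)
    qed
    show "AE \<omega> in M. norm (tail_bound (real (Suc n)) \<omega>) \<le> 1" for n
      using tail_bound_bounds[of "real (Suc n)"] by (intro AE_I2) auto
  qed auto
  then show ?thesis by simp
qed

text \<open>The two entries of the minimum in \<open>tail_bound\<close> come from two estimates:
  dropping the truncation leaves the conditional variance 1, and \<open>truncation_pointwise\<close>
  brings in the conditional moment of order 2 + delta. The supremum is finite almost everywhere, so
  \<open>enn2real\<close> is faithful there.\<close>

lemma nn_cond_exp_truncated:
  assumes t: "t \<ge> 1" and m: "m \<ge> 1"
  shows "AE \<omega> in M. nn_cond_exp M (F (t - 1)) (\<lambda>\<omega>. ennreal ((e t \<omega>)\<^sup>2 * min 1 (\<bar>e t \<omega>\<bar> / m ^ 4))) \<omega>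
    \<le> ennreal (tail_bound m \<omega>)"
proof -
  interpret sigma_finite_subalgebra M "F (t - 1)" by (rule sigma_finite_subalgebra_F)
  note [measurable] = e_measurable[OF t]
  let ?g = "\<lambda>\<omega>. ennreal ((e t \<omega>)\<^sup>2 * min 1 (\<bar>e t \<omega>\<bar> / m ^ 4))"
  let ?p = "\<lambda>\<omega>. ennreal (\<bar>e t \<omega>\<bar> powr (2 + \<delta>))"
  let ?E = "nn_cond_exp M (F (t - 1))"
  have a1: "AE \<omega> in M. ?E ?g \<omega> \<le> ?E (\<lambda>\<omega>. ennreal ((e t \<omega>)\<^sup>2)) \<omega>"
    by (rule nn_cond_exp_mono) (auto intro!: AE_I2 ennreal_leI mult_left_le)
  have a2: "AE \<omega> in M. ?E ?g \<omega> \<le> ?E (\<lambda>\<omega>. ennreal (1 / m) + ennreal (m powr (- \<delta>)) * ?p \<omega>) \<omega>"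
  proof (rule nn_cond_exp_mono)
    have "?g \<omega> \<le> ennreal (1 / m) + ennreal (m powr (- \<delta>)) * ?p \<omega>" for \<omega>
      using truncation_pointwise[OF m \<delta>_pos, of "e t \<omega>"] m
      by (simp add: ennreal_leI flip: ennreal_mult ennreal_plus)
    then show "AE \<omega> in M. ?g \<omega> \<le> ennreal (1 / m) + ennreal (m powr (- \<delta>)) * ?p \<omega>" by simp
  qed measurable
  have a3: "AE \<omega> in M. ?E (\<lambda>_. ennreal (1 / m)) \<omega> + ?E (\<lambda>\<omega>. ennreal (m powr (- \<delta>)) * ?p \<omega>) \<omega>
      = ?E (\<lambda>\<omega>. ennreal (1 / m) + ennreal (m powr (- \<delta>)) * ?p \<omega>) \<omega>"
    by (rule nn_cond_exp_sum) measurable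
  have a4: "AE \<omega> in M. ennreal (1 / m) = ?E (\<lambda>_. ennreal (1 / m)) \<omega>"
    by (rule nn_cond_exp_F_meas) simp
  have a5: "AE \<omega> in M. ennreal (m powr (- \<delta>)) * ?E ?p \<omega> = ?E (\<lambda>\<omega>. ennreal (m powr (- \<delta>)) * ?p \<omega>) \<omega>"
    by (rule nn_cond_exp_prod) measurable
  from a1 a2 a3 a4 a5 nn_cond_exp_e_sq[OF t] e_moment show ?thesis
  proof eventually_elim
    case (elim \<omega>)
    have fin: "moment_sup \<omega> < top" using elim(7) by (simp add: moment_sup_def)
    have "?E ?g \<omega> \<le> ennreal (1 / m) + ennreal (m powr (- \<delta>)) * ?E ?p \<omega>"
      using elim(2) unfolding elim(3)[symmetric] elim(4)[symmetric] elim(5)[symmetric] .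
    also have "?E ?p \<omega> \<le> moment_sup \<omega>" unfolding moment_sup_def using t by (intro SUP_upper) auto
    also have "moment_sup \<omega> = ennreal (enn2real (moment_sup \<omega>))" using fin by simp
    finally have "?E ?g \<omega> \<le> ennreal (1 / m) + ennreal (m powr (- \<delta>)) * ennreal (enn2real (moment_sup \<omega>))"
      by (simp add: add_left_mono mult_left_mono)
    also have "\<dots> = ennreal (1 / m + m powr (- \<delta>) * enn2real (moment_sup \<omega>))"
      using m by (simp add: ennreal_mult ennreal_plus)
    finally have "?E ?g \<omega> \<le> ennreal (1 / m + m powr (- \<delta>) * enn2real (moment_sup \<omega>))" .
    moreover have "?E ?g \<omega> \<le> ennreal 1" using elim(1,6) by simp
    ultimately show ?case by (simp add: tail_bound_def min_def)
  qed
qed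

text \<open>Where the weight exceeds \<open>1 / m ^ 4\<close> the truncation is given up and the
  full w^2 is paid; elsewhere the truncated conditional moment applies. Both prefactors are
  predictable, so the noise can be conditioned away; the estimate runs in nonnegative integrals and
  is converted at the end.\<close>

lemma lindeberg_term:
  assumes t: "t \<ge> 1" and m: "m \<ge> 1" and w: "w \<in> borel_measurable (F (t - 1))"
    and w1: "\<And>\<omega>. \<omega> \<in> space M \<Longrightarrow> \<bar>w \<omega>\<bar> \<le> 1"
  shows "(\<integral>\<omega>. (w \<omega> * e t \<omega>)\<^sup>2 * min 1 \<bar>w \<omega> * e t \<omega>\<bar> \<partial>M)
    \<le> (\<integral>\<omega>. (if \<bar>w \<omega>\<bar> > 1 / m ^ 4 then (w \<omega>)\<^sup>2 else 0) + (w \<omega>)\<^sup>2 * tail_bound m \<omega> \<partial>M)"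
proof -
  interpret sigma_finite_subalgebra M "F (t - 1)" by (rule sigma_finite_subalgebra_F)
  note [measurable] = w measurable_F_M[OF w] e_measurable[OF t]
  let ?g = "\<lambda>\<omega>. ennreal ((e t \<omega>)\<^sup>2 * min 1 (\<bar>e t \<omega>\<bar> / m ^ 4))"
  define v where "v \<omega> = (if \<bar>w \<omega>\<bar> > 1 / m ^ 4 then (w \<omega>)\<^sup>2 else 0)" for \<omega>
  have v[measurable]: "v \<in> borel_measurable (F (t - 1))" unfolding v_def by measurable
  note [measurable] = measurable_F_M[OF v]
  have v0: "0 \<le> v \<omega>" for \<omega> by (simp add: v_def)
  have v1: "v \<omega> \<le> (w \<omega>)\<^sup>2" for \<omega> by (simp add: v_def)
  have T0: "0 \<le> tail_bound m \<omega>" "tail_bound m \<omega> \<le> 1" for \<omega> using tail_bound_bounds[OF m] by auto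
  have w2: "(w \<omega>)\<^sup>2 \<le> 1" if "\<omega> \<in> space M" for \<omega> using w1[OF that] by (simp add: abs_square_le_1)
  have pw: "(w \<omega> * e t \<omega>)\<^sup>2 * min 1 \<bar>w \<omega> * e t \<omega>\<bar>
      \<le> v \<omega> * (e t \<omega>)\<^sup>2 + (w \<omega>)\<^sup>2 * ((e t \<omega>)\<^sup>2 * min 1 (\<bar>e t \<omega>\<bar> / m ^ 4))" for \<omega>
  proof (cases "\<bar>w \<omega>\<bar> > 1 / m ^ 4")
    case True
    have "(w \<omega> * e t \<omega>)\<^sup>2 * min 1 \<bar>w \<omega> * e t \<omega>\<bar> \<le> (w \<omega> * e t \<omega>)\<^sup>2" by (intro mult_left_le) auto
    also have "\<dots> = v \<omega> * (e t \<omega>)\<^sup>2" using True by (simp add: v_def power_mult_distrib)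
    finally show ?thesis by (rule order_trans) simp
  next
    case False
    then have "\<bar>w \<omega>\<bar> * \<bar>e t \<omega>\<bar> \<le> 1 / m ^ 4 * \<bar>e t \<omega>\<bar>" by (intro mult_right_mono) auto
    then have "min 1 \<bar>w \<omega> * e t \<omega>\<bar> \<le> min 1 (\<bar>e t \<omega>\<bar> / m ^ 4)" by (simp add: abs_mult)
    then have "(w \<omega> * e t \<omega>)\<^sup>2 * min 1 \<bar>w \<omega> * e t \<omega>\<bar> \<le> (w \<omega> * e t \<omega>)\<^sup>2 * min 1 (\<bar>e t \<omega>\<bar> / m ^ 4)"
      by (intro mult_left_mono) auto
    then show ?thesis using False by (simp add: v_def power_mult_distrib mult.assoc)
  qed
  have int: "integrable M (\<lambda>\<omega>. v \<omega> + (w \<omega>)\<^sup>2 * tail_bound m \<omega>)"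
  proof (rule integrable_const_bound[where B = 2])
    show "AE \<omega> in M. norm (v \<omega> + (w \<omega>)\<^sup>2 * tail_bound m \<omega>) \<le> 2"
    proof (rule AE_I2)
      fix \<omega> assume "\<omega> \<in> space M"
      then have "(w \<omega>)\<^sup>2 * tail_bound m \<omega> \<le> 1" "v \<omega> \<le> 1"
        using w2 T0 order_trans[OF v1] by (auto intro: mult_le_one)
      then show "norm (v \<omega> + (w \<omega>)\<^sup>2 * tail_bound m \<omega>) \<le> 2"
        using v0[of \<omega>] T0[of \<omega>] by simp
    qed
  qed measurable
  have "(\<integral>\<^sup>+\<omega>. ennreal ((w \<omega> * e t \<omega>)\<^sup>2 * min 1 \<bar>w \<omega> * e t \<omega>\<bar>) \<partial>M)
    \<le> (\<integral>\<^sup>+\<omega>. ennreal (v \<omega>) * ennreal ((e t \<omega>)\<^sup>2) + ennreal ((w \<omega>)\<^sup>2) * ?g \<omega> \<partial>M)"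
    using pw v0 by (intro nn_integral_mono) (simp add: ennreal_leI flip: ennreal_mult ennreal_plus)
  also have "\<dots> = (\<integral>\<^sup>+\<omega>. ennreal (v \<omega>) * ennreal ((e t \<omega>)\<^sup>2) \<partial>M) + (\<integral>\<^sup>+\<omega>. ennreal ((w \<omega>)\<^sup>2) * ?g \<omega> \<partial>M)"
    by (rule nn_integral_add) measurable
  also have "(\<integral>\<^sup>+\<omega>. ennreal (v \<omega>) * ennreal ((e t \<omega>)\<^sup>2) \<partial>M) = (\<integral>\<^sup>+\<omega>. ennreal (v \<omega>) \<partial>M)"
    by (rule nn_integral_mult_e_sq[OF t]) measurable
  also have "(\<integral>\<^sup>+\<omega>. ennreal ((w \<omega>)\<^sup>2) * ?g \<omega> \<partial>M) = (\<integral>\<^sup>+\<omega>. ennreal ((w \<omega>)\<^sup>2) * nn_cond_exp M (F (t - 1)) ?g \<omega> \<partial>M)"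
    by (rule nn_cond_exp_intg[symmetric]) measurable
  also have "\<dots> \<le> (\<integral>\<^sup>+\<omega>. ennreal ((w \<omega>)\<^sup>2) * ennreal (tail_bound m \<omega>) \<partial>M)"
  proof (rule nn_integral_mono_AE)
    show "AE \<omega> in M. ennreal ((w \<omega>)\<^sup>2) * nn_cond_exp M (F (t - 1)) ?g \<omega> \<le> ennreal ((w \<omega>)\<^sup>2) * ennreal (tail_bound m \<omega>)"
      using nn_cond_exp_truncated[OF t m] by eventually_elim (rule mult_left_mono, simp_all)
  qed
  also have "(\<integral>\<^sup>+\<omega>. ennreal (v \<omega>) \<partial>M) + \<dots> = (\<integral>\<^sup>+\<omega>. ennreal (v \<omega> + (w \<omega>)\<^sup>2 * tail_bound m \<omega>) \<partial>M)"
    using v0 T0 by (subst nn_integral_add[symmetric]) (auto simp: ennreal_mult ennreal_plus)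
  also have "\<dots> = ennreal (\<integral>\<omega>. v \<omega> + (w \<omega>)\<^sup>2 * tail_bound m \<omega> \<partial>M)"
    using v0 T0 by (intro nn_integral_eq_integral int) auto
  finally have *: "(\<integral>\<^sup>+\<omega>. ennreal ((w \<omega> * e t \<omega>)\<^sup>2 * min 1 \<bar>w \<omega> * e t \<omega>\<bar>) \<partial>M)
    \<le> ennreal (\<integral>\<omega>. v \<omega> + (w \<omega>)\<^sup>2 * tail_bound m \<omega> \<partial>M)" by (simp add: add_left_mono)
  have "0 \<le> (\<integral>\<omega>. v \<omega> + (w \<omega>)\<^sup>2 * tail_bound m \<omega> \<partial>M)" using v0 T0 by (intro integral_nonneg_AE) auto
  with * have "(\<integral>\<omega>. (w \<omega> * e t \<omega>)\<^sup>2 * min 1 \<bar>w \<omega> * e t \<omega>\<bar> \<partial>M) \<le> (\<integral>\<omega>. v \<omega> + (w \<omega>)\<^sup>2 * tail_bound m \<omega> \<partial>M)"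
    by (subst integral_eq_nn_integral) (auto intro: enn2real_leI)
  then show ?thesis by (simp add: v_def)
qed

section \<open>One row of the array of weights\<close>

text \<open>The row length \<open>n\<close> is fixed and every estimate is nonasymptotic. The
  uniform bound \<open>b\<close> on the weights is a random variable, because it will be a multiple
  of 1 / sqrt \<open>s0\<close>.\<close>

context
  fixes n :: nat and w :: "nat \<Rightarrow> 'a \<Rightarrow> real" and b :: "'a \<Rightarrow> real"
  assumes w_pred: "\<And>t. t \<in> {1..n} \<Longrightarrow> w t \<in> borel_measurable (F (t - 1))"
    and w_sum: "\<And>\<omega>. \<omega> \<in> space M \<Longrightarrow> (\<Sum>t=1..n. (w t \<omega>)\<^sup>2) \<le> 1"
    and b_meas [measurable]: "b \<in> borel_measurable M"
    and w_b: "\<And>t \<omega>. t \<in> {1..n} \<Longrightarrow> \<omega> \<in> space M \<Longrightarrow> \<bar>w t \<omega>\<bar> \<le> b \<omega>"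
begin

lemma w_measurable: "t \<in> {1..n} \<Longrightarrow> w t \<in> borel_measurable M"
  using w_pred measurable_F_M by blast

lemma w_partial_sum: "t \<le> n \<Longrightarrow> \<omega> \<in> space M \<Longrightarrow> (\<Sum>i=1..t. (w i \<omega>)\<^sup>2) \<le> 1"
  using sum_mono2[of "{1..n}" "{1..t}" "\<lambda>i. (w i \<omega>)\<^sup>2"] w_sum[of \<omega>] by force

lemma w_abs_le_1: "t \<in> {1..n} \<Longrightarrow> \<omega> \<in> space M \<Longrightarrow> \<bar>w t \<omega>\<bar> \<le> 1"
proof -
  assume "t \<in> {1..n}" "\<omega> \<in> space M"
  then have "(w t \<omega>)\<^sup>2 \<le> 1"
    using member_le_sum[of t "{1..n}" "\<lambda>i. (w i \<omega>)\<^sup>2"] w_sum[of \<omega>] by auto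
  then show "\<bar>w t \<omega>\<bar> \<le> 1" by (simp add: abs_square_le_1)
qed

lemma integrable_w_e_sq:
  assumes t: "t \<in> {1..n}"
  shows "integrable M (\<lambda>\<omega>. (w t \<omega> * e t \<omega>)\<^sup>2)" and "(\<integral>\<omega>. (w t \<omega> * e t \<omega>)\<^sup>2 \<partial>M) = (\<integral>\<omega>. (w t \<omega>)\<^sup>2 \<partial>M)"
proof -
  have t1: "t \<ge> 1" using t by simp
  note [measurable] = w_measurable[OF t] e_measurable[OF t1] w_pred[OF t]
  have "(\<integral>\<^sup>+\<omega>. ennreal ((w t \<omega>)\<^sup>2) * ennreal ((e t \<omega>)\<^sup>2) \<partial>M) = (\<integral>\<^sup>+\<omega>. ennreal ((w t \<omega>)\<^sup>2) \<partial>M)"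
    by (rule nn_integral_mult_e_sq[OF t1]) measurable
  then have eq: "(\<integral>\<^sup>+\<omega>. ennreal ((w t \<omega> * e t \<omega>)\<^sup>2) \<partial>M) = (\<integral>\<^sup>+\<omega>. ennreal ((w t \<omega>)\<^sup>2) \<partial>M)"
    by (simp add: power_mult_distrib ennreal_mult)
  have "(\<integral>\<^sup>+\<omega>. ennreal ((w t \<omega>)\<^sup>2) \<partial>M) \<le> (\<integral>\<^sup>+\<omega>. 1 \<partial>M)"
    using w_abs_le_1[OF t] by (intro nn_integral_mono) (simp add: abs_square_le_1)
  also have "\<dots> < \<infinity>" by (simp add: emeasure_space_1)
  finally show "integrable M (\<lambda>\<omega>. (w t \<omega> * e t \<omega>)\<^sup>2)"
    by (intro integrableI_bounded) (simp_all add: eq)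
  show "(\<integral>\<omega>. (w t \<omega> * e t \<omega>)\<^sup>2 \<partial>M) = (\<integral>\<omega>. (w t \<omega>)\<^sup>2 \<partial>M)"
    by (simp add: integral_eq_nn_integral eq)
qed

lemma partial_sum_measurable: "t \<le> n \<Longrightarrow> (\<lambda>\<omega>. \<Sum>i=1..t. w i \<omega> * e i \<omega>) \<in> borel_measurable (F t)"
proof (rule borel_measurable_sum)
  fix i assume i: "t \<le> n" "i \<in> {1..t}"
  then have "w i \<in> borel_measurable (F t)" "e i \<in> borel_measurable (F t)"
    using measurable_F_mono[OF _ w_pred[of i], of t] measurable_F_mono[OF _ e_adapted[of i], of t] by auto
  then show "(\<lambda>\<omega>. w i \<omega> * e i \<omega>) \<in> borel_measurable (F t)" by measurable
qed

text \<open>Orthogonality of martingale increments: the cross term has a predictable factor and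
  integrates to 0. It is integrable because |xy| <= x^2 + y^2. The second moment makes the weighted
  noise tight.\<close>

lemma partial_sum_sq:
  assumes "t \<le> n"
  shows "integrable M (\<lambda>\<omega>. (\<Sum>i=1..t. w i \<omega> * e i \<omega>)\<^sup>2) \<and>
    (\<integral>\<omega>. (\<Sum>i=1..t. w i \<omega> * e i \<omega>)\<^sup>2 \<partial>M) = (\<integral>\<omega>. (\<Sum>i=1..t. (w i \<omega>)\<^sup>2) \<partial>M)"
  using assms
proof (induction t)
  case (Suc t)
  interpret sigma_finite_subalgebra M "F t" by (rule sigma_finite_subalgebra_F)
  have St: "Suc t \<in> {1..n}" using Suc by simp
  define S where "S \<omega> = (\<Sum>i=1..t. w i \<omega> * e i \<omega>)" for \<omega>
  define v where "v = w (Suc t)"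
  define d where "d = e (Suc t)"
  have S[measurable]: "S \<in> borel_measurable (F t)" unfolding S_def using Suc by (intro partial_sum_measurable) auto
  have v[measurable]: "v \<in> borel_measurable (F t)" using w_pred[OF St] by (simp add: v_def)
  have d[measurable]: "d \<in> borel_measurable M" unfolding d_def by (rule e_measurable) simp
  note [measurable] = measurable_F_M[OF S] measurable_F_M[OF v]
  have S2: "integrable M (\<lambda>\<omega>. (S \<omega>)\<^sup>2)" using Suc by (simp add: S_def)
  have vd2: "integrable M (\<lambda>\<omega>. (v \<omega> * d \<omega>)\<^sup>2)" "(\<integral>\<omega>. (v \<omega> * d \<omega>)\<^sup>2 \<partial>M) = (\<integral>\<omega>. (v \<omega>)\<^sup>2 \<partial>M)"
    using integrable_w_e_sq[OF St] by (simp_all add: v_def d_def)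
  have cross: "integrable M (\<lambda>\<omega>. (S \<omega> * v \<omega>) * d \<omega>)"
  proof (rule Bochner_Integration.integrable_bound)
    show "integrable M (\<lambda>\<omega>. (S \<omega>)\<^sup>2 + (v \<omega> * d \<omega>)\<^sup>2)" using S2 vd2 by simp
    have "\<bar>x * y\<bar> \<le> x\<^sup>2 + y\<^sup>2" for x y :: real
      using sum_squares_bound[of x y] sum_squares_bound[of x "- y"] zero_le_power2[of x] zero_le_power2[of y]
      by (simp add: abs_le_iff)
    from this[of "S _" "v _ * d _"] show "AE \<omega> in M. norm (S \<omega> * v \<omega> * d \<omega>) \<le> norm ((S \<omega>)\<^sup>2 + (v \<omega> * d \<omega>)\<^sup>2)"
      by (simp add: mult.assoc)
  qed measurable
  have "(\<integral>\<omega>. (S \<omega> * v \<omega>) * d \<omega> \<partial>M) = (\<integral>\<omega>. (S \<omega> * v \<omega>) * real_cond_exp M (F t) d \<omega> \<partial>M)"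
    by (rule real_cond_exp_intg(2)[OF cross, symmetric]) measurable
  also have "\<dots> = (\<integral>\<omega>. 0 \<partial>M)"
    using e_mean[of "Suc t"] by (intro integral_cong_AE) (auto simp: d_def)
  finally have cross0: "(\<integral>\<omega>. (S \<omega> * v \<omega>) * d \<omega> \<partial>M) = 0" by simp
  have expand: "(\<Sum>i=1..Suc t. w i \<omega> * e i \<omega>)\<^sup>2 = (S \<omega>)\<^sup>2 + 2 * ((S \<omega> * v \<omega>) * d \<omega>) + (v \<omega> * d \<omega>)\<^sup>2" for \<omega>
    by (simp add: S_def v_def d_def power2_sum algebra_simps)
  have iw: "integrable M (\<lambda>\<omega>. (w i \<omega>)\<^sup>2)" if "i \<in> {1..n}" for i
    using w_abs_le_1[OF that] w_measurable[OF that]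
    by (intro integrable_const_bound[where B = 1]) (auto simp: abs_square_le_1)
  show ?case
  proof
    show "integrable M (\<lambda>\<omega>. (\<Sum>i=1..Suc t. w i \<omega> * e i \<omega>)\<^sup>2)"
      unfolding expand using S2 vd2 cross by simp
    have "(\<integral>\<omega>. (\<Sum>i=1..Suc t. w i \<omega> * e i \<omega>)\<^sup>2 \<partial>M) = (\<integral>\<omega>. (S \<omega>)\<^sup>2 \<partial>M) + (\<integral>\<omega>. (v \<omega>)\<^sup>2 \<partial>M)"
      unfolding expand using S2 vd2 cross cross0 by simp
    also have "\<dots> = (\<integral>\<omega>. (\<Sum>i=1..t. (w i \<omega>)\<^sup>2) \<partial>M) + (\<integral>\<omega>. (v \<omega>)\<^sup>2 \<partial>M)"
      using Suc by (simp add: S_def)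
    also have "\<dots> = (\<integral>\<omega>. (\<Sum>i=1..Suc t. (w i \<omega>)\<^sup>2) \<partial>M)"
      using iw[OF St] Bochner_Integration.integrable_sum[of "{1..t}" M "\<lambda>i \<omega>. (w i \<omega>)\<^sup>2"] iw Suc.prems
      by (simp add: v_def)
    finally show "(\<integral>\<omega>. (\<Sum>i=1..Suc t. w i \<omega> * e i \<omega>)\<^sup>2 \<partial>M) = (\<integral>\<omega>. (\<Sum>i=1..Suc t. (w i \<omega>)\<^sup>2) \<partial>M)" .
  qed
qed simp


text \<open>Either \<open>b\<close> is at most the threshold and no weight passes it, or the total
  of the squares, at most 1, is a sufficient bound.\<close>

lemma big_weights_le:
  assumes \<omega>: "\<omega> \<in> space M"
  shows "(\<Sum>t=1..n. if \<bar>w t \<omega>\<bar> > \<eta> then (w t \<omega>)\<^sup>2 else 0) \<le> indicator {\<omega> \<in> space M. b \<omega> > \<eta>} \<omega>"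
proof (cases "b \<omega> > \<eta>")
  case True
  have "(\<Sum>t=1..n. if \<bar>w t \<omega>\<bar> > \<eta> then (w t \<omega>)\<^sup>2 else 0) \<le> (\<Sum>t=1..n. (w t \<omega>)\<^sup>2)"
    by (rule sum_mono) simp
  then show ?thesis using w_sum[OF \<omega>] True \<omega> by simp
next
  case False
  then have "\<not> \<bar>w t \<omega>\<bar> > \<eta>" if "t \<in> {1..n}" for t using w_b[OF that \<omega>] by linarith
  then show ?thesis using False by (simp add: sum.neutral)
qed

lemma integrable_w_power: "t \<in> {1..n} \<Longrightarrow> integrable M (\<lambda>\<omega>. (w t \<omega>) ^ p)"
  using w_abs_le_1[of t] w_measurable[of t]
  by (intro integrable_const_bound[where B = 1]) (auto simp: power_abs power_le_one)

text \<open>\<open>tail_bound\<close> does not depend on the round, so the squared weights in front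
  of it add up to at most 1 and the bound is free of the number of rounds.\<close>

lemma lindeberg_sum:
  assumes m: "m \<ge> 1"
  shows "(\<Sum>t=1..n. \<integral>\<omega>. (w t \<omega> * e t \<omega>)\<^sup>2 * min 1 \<bar>w t \<omega> * e t \<omega>\<bar> \<partial>M)
    \<le> prob {\<omega> \<in> space M. b \<omega> > 1 / m ^ 4} + (\<integral>\<omega>. tail_bound m \<omega> \<partial>M)"
proof -
  let ?v = "\<lambda>t \<omega>. if \<bar>w t \<omega>\<bar> > 1 / m ^ 4 then (w t \<omega>)\<^sup>2 else 0"
  have T: "0 \<le> tail_bound m \<omega>" "tail_bound m \<omega> \<le> 1" for \<omega> using tail_bound_bounds[OF m] by auto
  have int: "integrable M (\<lambda>\<omega>. ?v t \<omega> + (w t \<omega>)\<^sup>2 * tail_bound m \<omega>)" if t: "t \<in> {1..n}" for t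
  proof (rule Bochner_Integration.integrable_bound)
    note [measurable] = w_measurable[OF t]
    show "integrable M (\<lambda>\<omega>. 2 * (w t \<omega>)\<^sup>2)" using integrable_w_power[OF t] by simp
    show "AE \<omega> in M. norm (?v t \<omega> + (w t \<omega>)\<^sup>2 * tail_bound m \<omega>) \<le> norm (2 * (w t \<omega>)\<^sup>2)"
    proof (rule AE_I2)
      fix \<omega>
      have "(w t \<omega>)\<^sup>2 * tail_bound m \<omega> \<le> (w t \<omega>)\<^sup>2" using T by (intro mult_left_le) auto
      moreover have "0 \<le> (w t \<omega>)\<^sup>2 * tail_bound m \<omega>" using T by simp
      moreover have "0 \<le> ?v t \<omega>" "?v t \<omega> \<le> (w t \<omega>)\<^sup>2" by simp_all
      ultimately show "norm (?v t \<omega> + (w t \<omega>)\<^sup>2 * tail_bound m \<omega>) \<le> norm (2 * (w t \<omega>)\<^sup>2)"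
        unfolding real_norm_def by linarith
    qed
    show "(\<lambda>\<omega>. ?v t \<omega> + (w t \<omega>)\<^sup>2 * tail_bound m \<omega>) \<in> borel_measurable M" by measurable
  qed
  have "(\<Sum>t=1..n. \<integral>\<omega>. (w t \<omega> * e t \<omega>)\<^sup>2 * min 1 \<bar>w t \<omega> * e t \<omega>\<bar> \<partial>M)
    \<le> (\<Sum>t=1..n. \<integral>\<omega>. ?v t \<omega> + (w t \<omega>)\<^sup>2 * tail_bound m \<omega> \<partial>M)"
  proof (rule sum_mono)
    fix t assume t: "t \<in> {1..n}"
    show "(\<integral>\<omega>. (w t \<omega> * e t \<omega>)\<^sup>2 * min 1 \<bar>w t \<omega> * e t \<omega>\<bar> \<partial>M)
      \<le> (\<integral>\<omega>. ?v t \<omega> + (w t \<omega>)\<^sup>2 * tail_bound m \<omega> \<partial>M)"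
      by (rule lindeberg_term[OF _ m w_pred[OF t] w_abs_le_1[OF t]]) (use t in auto)
  qed
  also have "\<dots> = (\<integral>\<omega>. (\<Sum>t=1..n. ?v t \<omega> + (w t \<omega>)\<^sup>2 * tail_bound m \<omega>) \<partial>M)"
    using int by (intro Bochner_Integration.integral_sum[symmetric])
  also have "\<dots> \<le> (\<integral>\<omega>. indicator {\<omega> \<in> space M. b \<omega> > 1 / m ^ 4} \<omega> + tail_bound m \<omega> \<partial>M)"
  proof (rule integral_mono)
    show "integrable M (\<lambda>\<omega>. (\<Sum>t=1..n. ?v t \<omega> + (w t \<omega>)\<^sup>2 * tail_bound m \<omega>))"
      using int by (rule Bochner_Integration.integrable_sum)
    show "integrable M (\<lambda>\<omega>. indicator {\<omega> \<in> space M. b \<omega> > 1 / m ^ 4} \<omega> + tail_bound m \<omega>)"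
    proof (rule integrable_const_bound[where B = 2])
      have "norm (indicator {\<omega> \<in> space M. b \<omega> > 1 / m ^ 4} \<omega> + tail_bound m \<omega>) \<le> 2" for \<omega>
        using T[of \<omega>] by (cases "\<omega> \<in> {\<omega> \<in> space M. b \<omega> > 1 / m ^ 4}") simp_all
      then show "AE \<omega> in M. norm (indicator {\<omega> \<in> space M. b \<omega> > 1 / m ^ 4} \<omega> + tail_bound m \<omega>) \<le> 2"
        by simp
    qed measurable
    fix \<omega> assume \<omega>: "\<omega> \<in> space M"
    have "(\<Sum>t=1..n. (w t \<omega>)\<^sup>2) * tail_bound m \<omega> \<le> 1 * tail_bound m \<omega>"
      using w_sum[OF \<omega>] T by (intro mult_right_mono)
    with big_weights_le[OF \<omega>, of "1 / m ^ 4"]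
    show "(\<Sum>t=1..n. ?v t \<omega> + (w t \<omega>)\<^sup>2 * tail_bound m \<omega>) \<le> indicator {\<omega> \<in> space M. b \<omega> > 1 / m ^ 4} \<omega> + tail_bound m \<omega>"
      unfolding sum.distrib sum_distrib_right by linarith
  qed
  also have "\<dots> = prob {\<omega> \<in> space M. b \<omega> > 1 / m ^ 4} + (\<integral>\<omega>. tail_bound m \<omega> \<partial>M)"
    using T by (subst Bochner_Integration.integral_add)
      (auto intro!: integrable_const_bound[where B = 1] integrable_real_indicator AE_I2 simp: emeasure_eq_measure)
  finally show ?thesis .
qed

text \<open>Small weights satisfy w^4 <= eta^2 w^2, large ones w^4 <= w^2; the sums of squares are
  then at most 1 and \<open>big_weights_le\<close>. This controls the remainder of the exponential
  in the compensator.\<close>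

lemma fourth_power_sum:
  assumes \<eta>: "\<eta> \<ge> 0"
  shows "(\<Sum>t=1..n. \<integral>\<omega>. (w t \<omega>) ^ 4 \<partial>M) \<le> prob {\<omega> \<in> space M. b \<omega> > \<eta>} + \<eta>\<^sup>2"
proof -
  have "(\<Sum>t=1..n. \<integral>\<omega>. (w t \<omega>) ^ 4 \<partial>M) = (\<integral>\<omega>. (\<Sum>t=1..n. (w t \<omega>) ^ 4) \<partial>M)"
    using integrable_w_power by (intro Bochner_Integration.integral_sum[symmetric])
  also have "\<dots> \<le> (\<integral>\<omega>. indicator {\<omega> \<in> space M. b \<omega> > \<eta>} \<omega> + \<eta>\<^sup>2 \<partial>M)"
  proof (rule integral_mono)
    show "integrable M (\<lambda>\<omega>. (\<Sum>t=1..n. (w t \<omega>) ^ 4))"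
      using integrable_w_power by (rule Bochner_Integration.integrable_sum)
    show "integrable M (\<lambda>\<omega>. indicator {\<omega> \<in> space M. b \<omega> > \<eta>} \<omega> + \<eta>\<^sup>2)"
      by (auto intro!: integrable_real_indicator simp: emeasure_eq_measure)
    fix \<omega> assume \<omega>: "\<omega> \<in> space M"
    have "(w t \<omega>) ^ 4 \<le> (if \<bar>w t \<omega>\<bar> > \<eta> then (w t \<omega>)\<^sup>2 else 0) + (w t \<omega>)\<^sup>2 * \<eta>\<^sup>2" if t: "t \<in> {1..n}" for t
    proof -
      have eq: "(w t \<omega>) ^ 4 = (w t \<omega>)\<^sup>2 * (w t \<omega>)\<^sup>2" by (simp add: power2_eq_square eval_nat_numeral)
      show ?thesis
      proof (cases "\<bar>w t \<omega>\<bar> > \<eta>")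
        case True
        have "(w t \<omega>)\<^sup>2 * (w t \<omega>)\<^sup>2 \<le> (w t \<omega>)\<^sup>2"
          using w_abs_le_1[OF t \<omega>] by (intro mult_left_le) (auto simp: abs_square_le_1)
        moreover have "0 \<le> (w t \<omega>)\<^sup>2 * \<eta>\<^sup>2" by simp
        ultimately show ?thesis using True unfolding eq by (simp only: if_True)
      next
        case False
        then have "(w t \<omega>)\<^sup>2 \<le> \<eta>\<^sup>2" using \<eta> by (simp add: abs_le_square_iff[symmetric])
        then have "(w t \<omega>)\<^sup>2 * (w t \<omega>)\<^sup>2 \<le> (w t \<omega>)\<^sup>2 * \<eta>\<^sup>2" by (intro mult_left_mono) auto
        then show ?thesis using False unfolding eq by simp
      qed
    qed
    then have "(\<Sum>t=1..n. (w t \<omega>) ^ 4) \<le> (\<Sum>t=1..n. (if \<bar>w t \<omega>\<bar> > \<eta> then (w t \<omega>)\<^sup>2 else 0) + (w t \<omega>)\<^sup>2 * \<eta>\<^sup>2)"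
      by (rule sum_mono)
    also have "\<dots> = (\<Sum>t=1..n. if \<bar>w t \<omega>\<bar> > \<eta> then (w t \<omega>)\<^sup>2 else 0) + (\<Sum>t=1..n. (w t \<omega>)\<^sup>2) * \<eta>\<^sup>2"
      by (simp add: sum.distrib sum_distrib_right)
    also have "\<dots> \<le> indicator {\<omega> \<in> space M. b \<omega> > \<eta>} \<omega> + 1 * \<eta>\<^sup>2"
      using w_sum[OF \<omega>] by (intro add_mono big_weights_le[OF \<omega>] mult_right_mono) auto
    finally show "(\<Sum>t=1..n. (w t \<omega>) ^ 4) \<le> indicator {\<omega> \<in> space M. b \<omega> > \<eta>} \<omega> + \<eta>\<^sup>2" by simp
  qed
  also have "\<dots> = prob {\<omega> \<in> space M. b \<omega> > \<eta>} + \<eta>\<^sup>2"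
    by (subst Bochner_Integration.integral_add)
      (auto intro!: integrable_real_indicator simp: emeasure_eq_measure prob_space)
  finally show ?thesis .
qed

text \<open>The compensator is predictable and bounded by \<open>exp (u\<^sup>2 / 2)\<close>, so the expectation telescopes
  into the increments controlled by \<open>char_step\<close>.\<close>
lemma compensated_char:
  assumes "t \<le> n"
  shows "cmod ((\<integral>\<omega>. iexp (u * (\<Sum>i=1..t. w i \<omega> * e i \<omega>)) *
      complex_of_real (exp (u\<^sup>2 * (\<Sum>i=1..t. (w i \<omega>)\<^sup>2) / 2)) \<partial>M) - 1)
    \<le> exp (u\<^sup>2 / 2) * (\<Sum>i=1..t. (\<integral>\<omega>. (u * (w i \<omega> * e i \<omega>))\<^sup>2 * min 1 \<bar>u * (w i \<omega> * e i \<omega>)\<bar> \<partial>M)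
        + (\<integral>\<omega>. (u * w i \<omega>) ^ 4 / 8 \<partial>M))"
  using assms
proof (induction t)
  case 0
  then show ?case by (simp add: prob_space)
next
  case (Suc t)
  define S where "S t \<omega> = (\<Sum>i=1..t. w i \<omega> * e i \<omega>)" for t \<omega>
  define V where "V t \<omega> = (\<Sum>i=1..t. (w i \<omega>)\<^sup>2)" for t \<omega>
  define Z where "Z t \<omega> = iexp (u * S t \<omega>) * complex_of_real (exp (u\<^sup>2 * V t \<omega> / 2))" for t \<omega>
  \<comment> \<open>The compensator already includes round \<open>Suc t\<close>: its weight is
    predictable, so \<open>A\<close> is still measurable for \<open>F t\<close>, and the increment
    of \<open>Z\<close> becomes \<open>A\<close> times exactly the difference that
    \<open>char_step\<close> handles.\<close>
  define A where "A \<omega> = iexp (u * S t \<omega>) * complex_of_real (exp (u\<^sup>2 * V (Suc t) \<omega> / 2))" for \<omega>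
  have St: "Suc t \<in> {1..n}" using Suc.prems by simp
  have VF: "V s \<in> borel_measurable (F t)" if "s \<le> Suc t" for s
    unfolding V_def
  proof (rule borel_measurable_sum)
    fix i assume "i \<in> {1..s}"
    then have "w i \<in> borel_measurable (F t)"
      using that Suc.prems by (intro measurable_F_mono[OF _ w_pred[of i]]) auto
    then show "(\<lambda>\<omega>. (w i \<omega>)\<^sup>2) \<in> borel_measurable (F t)" by measurable
  qed
  have SF: "S s \<in> borel_measurable (F s)" if "s \<le> n" for s
    unfolding S_def using that by (rule partial_sum_measurable)
  have V1: "V t \<in> borel_measurable (F t)" "V (Suc t) \<in> borel_measurable (F t)" using VF by auto
  have tn: "t \<le> n" using Suc.prems by simp
  note [measurable] = measurable_F_M[OF SF[OF tn]] measurable_F_M[OF SF[OF Suc.prems]]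
    measurable_F_M[OF V1(1)] measurable_F_M[OF V1(2)]
  have A_meas: "A \<in> borel_measurable (F t)"
    unfolding A_def using SF[OF tn] V1(2) by measurable
  have bd: "exp (u\<^sup>2 * V s \<omega> / 2) \<le> exp (u\<^sup>2 / 2)" if "s \<le> n" "\<omega> \<in> space M" for s \<omega>
    using w_partial_sum[OF that] by (simp add: V_def mult_left_le)
  have A_bd: "cmod (A \<omega>) \<le> exp (u\<^sup>2 / 2)" if "\<omega> \<in> space M" for \<omega>
    using bd[OF Suc.prems that] by (simp add: A_def norm_mult)
  have Z_int: "integrable M (Z s)" if "s = t \<or> s = Suc t" for s
  proof (rule integrable_const_bound[where B = "exp (u\<^sup>2 / 2)"])
    show "AE \<omega> in M. norm (Z s \<omega>) \<le> exp (u\<^sup>2 / 2)"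
      using bd[of s] that tn Suc.prems by (intro AE_I2) (auto simp: Z_def norm_mult)
    show "Z s \<in> borel_measurable M" using that unfolding Z_def by auto
  qed
  have step: "Z (Suc t) \<omega> - Z t \<omega> = A \<omega> * (iexp (u * (w (Suc t) \<omega> * e (Suc t) \<omega>)) -
      complex_of_real (exp (- ((u * w (Suc t) \<omega>)\<^sup>2 / 2))))" for \<omega>
  proof -
    have 1: "iexp (u * S (Suc t) \<omega>) = iexp (u * S t \<omega>) * iexp (u * (w (Suc t) \<omega> * e (Suc t) \<omega>))"
      by (simp add: S_def mult_exp_exp algebra_simps)
    have 2: "exp (u\<^sup>2 * V (Suc t) \<omega> / 2) * exp (- ((u * w (Suc t) \<omega>)\<^sup>2 / 2)) = exp (u\<^sup>2 * V t \<omega> / 2)"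
      by (simp add: V_def mult_exp_exp power_mult_distrib add_divide_distrib distrib_left)
    show ?thesis unfolding Z_def A_def 1 2[symmetric] by (simp add: algebra_simps)
  qed
  have "(\<integral>\<omega>. Z (Suc t) \<omega> \<partial>M) - (\<integral>\<omega>. Z t \<omega> \<partial>M) = (\<integral>\<omega>. Z (Suc t) \<omega> - Z t \<omega> \<partial>M)"
    using Z_int by simp
  also have "cmod \<dots> \<le> exp (u\<^sup>2 / 2) * ((\<integral>\<omega>. (u * (w (Suc t) \<omega> * e (Suc t) \<omega>))\<^sup>2 * min 1 \<bar>u * (w (Suc t) \<omega> * e (Suc t) \<omega>)\<bar> \<partial>M)
        + (\<integral>\<omega>. (u * w (Suc t) \<omega>) ^ 4 / 8 \<partial>M))"
    unfolding step
    by (rule char_step) (use A_meas A_bd w_pred[OF St] w_abs_le_1[OF St] in auto)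
  finally have inc: "cmod ((\<integral>\<omega>. Z (Suc t) \<omega> \<partial>M) - (\<integral>\<omega>. Z t \<omega> \<partial>M)) \<le> exp (u\<^sup>2 / 2) *
      ((\<integral>\<omega>. (u * (w (Suc t) \<omega> * e (Suc t) \<omega>))\<^sup>2 * min 1 \<bar>u * (w (Suc t) \<omega> * e (Suc t) \<omega>)\<bar> \<partial>M)
        + (\<integral>\<omega>. (u * w (Suc t) \<omega>) ^ 4 / 8 \<partial>M))" .
  have "cmod ((\<integral>\<omega>. Z (Suc t) \<omega> \<partial>M) - 1) \<le> cmod ((\<integral>\<omega>. Z (Suc t) \<omega> \<partial>M) - (\<integral>\<omega>. Z t \<omega> \<partial>M)) + cmod ((\<integral>\<omega>. Z t \<omega> \<partial>M) - 1)"
    by (rule norm_diff_triangle_le) auto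
  also have "\<dots> \<le> exp (u\<^sup>2 / 2) * (\<Sum>i=1..Suc t. (\<integral>\<omega>. (u * (w i \<omega> * e i \<omega>))\<^sup>2 * min 1 \<bar>u * (w i \<omega> * e i \<omega>)\<bar> \<partial>M)
        + (\<integral>\<omega>. (u * w i \<omega>) ^ 4 / 8 \<partial>M))"
    using add_mono[OF inc Suc.IH[OF tn, folded S_def V_def, folded Z_def]]
    by (simp add: distrib_left add.commute)
  finally show ?case unfolding Z_def S_def V_def .
qed


text \<open>Since the squared weights never exceed 1, the random compensator can be replaced by its
  maximum exp (u^2/2) at a cost proportional to 1 minus their sum. Every error term carries this
  maximum as a factor, and dividing by it removes it.\<close>

lemma char_weighted_sum:
  "cmod ((\<integral>\<omega>. iexp (u * (\<Sum>t=1..n. w t \<omega> * e t \<omega>)) \<partial>M) - complex_of_real (exp (- (u\<^sup>2 / 2))))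
    \<le> u\<^sup>2 * (1 + \<bar>u\<bar>) * (\<Sum>t=1..n. \<integral>\<omega>. (w t \<omega> * e t \<omega>)\<^sup>2 * min 1 \<bar>w t \<omega> * e t \<omega>\<bar> \<partial>M)
      + u ^ 4 / 8 * (\<Sum>t=1..n. \<integral>\<omega>. (w t \<omega>) ^ 4 \<partial>M)
      + u\<^sup>2 / 2 * (\<integral>\<omega>. 1 - (\<Sum>t=1..n. (w t \<omega>)\<^sup>2) \<partial>M)"
proof -
  define S where "S \<omega> = (\<Sum>t=1..n. w t \<omega> * e t \<omega>)" for \<omega>
  define V where "V \<omega> = (\<Sum>t=1..n. (w t \<omega>)\<^sup>2)" for \<omega>
  define E where "E = exp (u\<^sup>2 / 2)"
  define I where "I = (\<integral>\<omega>. iexp (u * S \<omega>) \<partial>M)"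
  define J where "J = (\<integral>\<omega>. iexp (u * S \<omega>) * complex_of_real (exp (u\<^sup>2 * V \<omega> / 2)) \<partial>M)"
  define L where "L t = (\<integral>\<omega>. (w t \<omega> * e t \<omega>)\<^sup>2 * min 1 \<bar>w t \<omega> * e t \<omega>\<bar> \<partial>M)" for t
  have E0: "E > 0" by (simp add: E_def)
  have [measurable]: "S \<in> borel_measurable M"
    unfolding S_def using measurable_F_M[OF partial_sum_measurable[of n]] by simp
  have [measurable]: "V \<in> borel_measurable M" unfolding V_def
    by (rule borel_measurable_sum) (use w_measurable in measurable)
  have V: "0 \<le> V \<omega>" "V \<omega> \<le> 1" if "\<omega> \<in> space M" for \<omega>
    using w_sum[OF that] by (auto simp: V_def sum_nonneg)
  have expV: "exp (u\<^sup>2 * V \<omega> / 2) \<le> E" if "\<omega> \<in> space M" for \<omega>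
    using V[OF that] by (simp add: E_def mult_left_le)
  have intS: "integrable M (\<lambda>\<omega>. iexp (u * S \<omega>))"
    by (rule integrable_const_bound[where B = 1]) auto
  have intJ: "integrable M (\<lambda>\<omega>. iexp (u * S \<omega>) * complex_of_real (exp (u\<^sup>2 * V \<omega> / 2)))"
    by (rule integrable_const_bound[where B = E]) (use expV in \<open>auto simp: norm_mult\<close>)
  have intV: "integrable M (\<lambda>\<omega>. 1 - V \<omega>)"
    by (rule integrable_const_bound[where B = 1]) (use V in auto)
  have "E * I - J = (\<integral>\<omega>. E * iexp (u * S \<omega>) - iexp (u * S \<omega>) * complex_of_real (exp (u\<^sup>2 * V \<omega> / 2)) \<partial>M)"
    unfolding I_def J_def using intS intJ by simp
  also have "cmod \<dots> \<le> (\<integral>\<omega>. E * (u\<^sup>2 / 2) * (1 - V \<omega>) \<partial>M)"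
  proof (rule norm_integral_le)
    fix \<omega> assume \<omega>: "\<omega> \<in> space M"
    have "E * iexp (u * S \<omega>) - iexp (u * S \<omega>) * complex_of_real (exp (u\<^sup>2 * V \<omega> / 2))
      = iexp (u * S \<omega>) * complex_of_real (E - exp (u\<^sup>2 * V \<omega> / 2))" by (simp add: algebra_simps)
    then have "cmod (E * iexp (u * S \<omega>) - iexp (u * S \<omega>) * complex_of_real (exp (u\<^sup>2 * V \<omega> / 2)))
      = \<bar>E - exp (u\<^sup>2 * V \<omega> / 2)\<bar>"
      by (simp only: norm_mult norm_exp_i_times mult_1_left norm_of_real)
    also have "\<dots> = E - exp (u\<^sup>2 * V \<omega> / 2)" using expV[OF \<omega>] by simp
    also have "\<dots> = E * (1 - exp (- (u\<^sup>2 / 2 * (1 - V \<omega>))))"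
    proof -
      have "E * exp (- (u\<^sup>2 / 2 * (1 - V \<omega>))) = exp (u\<^sup>2 * V \<omega> / 2)"
      proof -
        have "u\<^sup>2 / 2 + - (u\<^sup>2 / 2 * (1 - V \<omega>)) = u\<^sup>2 * V \<omega> / 2" by (simp add: field_simps)
        then show ?thesis unfolding E_def mult_exp_exp by simp
      qed
      then show ?thesis by (simp add: right_diff_distrib)
    qed
    also have "\<dots> \<le> E * (u\<^sup>2 / 2 * (1 - V \<omega>))"
      using exp_ge_add_one_self[of "- (u\<^sup>2 / 2 * (1 - V \<omega>))"] E0 by (intro mult_left_mono) auto
    finally show "cmod (E * iexp (u * S \<omega>) - iexp (u * S \<omega>) * complex_of_real (exp (u\<^sup>2 * V \<omega> / 2)))
      \<le> E * (u\<^sup>2 / 2) * (1 - V \<omega>)" by (simp only: mult.assoc)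
  qed (use intS intJ intV in auto)
  also have "\<dots> = E * (u\<^sup>2 / 2 * (\<integral>\<omega>. 1 - V \<omega> \<partial>M))"
    using intV by (simp only: integral_mult_right_zero mult.assoc)
  finally have 1: "cmod (E * I - J) \<le> E * (u\<^sup>2 / 2 * (\<integral>\<omega>. 1 - V \<omega> \<partial>M))" .
  have "cmod (J - 1) \<le> E * (\<Sum>i=1..n. (\<integral>\<omega>. (u * (w i \<omega> * e i \<omega>))\<^sup>2 * min 1 \<bar>u * (w i \<omega> * e i \<omega>)\<bar> \<partial>M)
        + (\<integral>\<omega>. (u * w i \<omega>) ^ 4 / 8 \<partial>M))"
    using compensated_char[OF order_refl, of u] by (simp only: J_def E_def S_def V_def)
  also have "\<dots> \<le> E * (\<Sum>i=1..n. u\<^sup>2 * (1 + \<bar>u\<bar>) * L i + u ^ 4 / 8 * (\<integral>\<omega>. (w i \<omega>) ^ 4 \<partial>M))"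
  proof (intro mult_left_mono sum_mono add_mono)
    fix i assume i: "i \<in> {1..n}"
    note [measurable] = w_measurable[OF i] e_measurable[of i]
    have i1: "1 \<le> i" using i by simp
    have ub: "norm ((c * (w i \<omega> * e i \<omega>))\<^sup>2 * min 1 \<bar>c * (w i \<omega> * e i \<omega>)\<bar>) \<le> norm (c\<^sup>2 * (w i \<omega> * e i \<omega>)\<^sup>2)" for c \<omega>
      by (auto simp: abs_mult power_mult_distrib intro!: mult_left_le)
    \<comment> \<open>A general factor \<open>c\<close>, because both c = u and c = 1 occur in the
      comparison that follows.\<close>
    have int: "integrable M (\<lambda>\<omega>. (c * (w i \<omega> * e i \<omega>))\<^sup>2 * min 1 \<bar>c * (w i \<omega> * e i \<omega>)\<bar>)" for c
      by (rule Bochner_Integration.integrable_bound[of _ "\<lambda>\<omega>. c\<^sup>2 * (w i \<omega> * e i \<omega>)\<^sup>2"])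
        (use integrable_w_e_sq(1)[OF i] ub i1 in auto)
    have "(\<integral>\<omega>. (u * (w i \<omega> * e i \<omega>))\<^sup>2 * min 1 \<bar>u * (w i \<omega> * e i \<omega>)\<bar> \<partial>M)
      \<le> (\<integral>\<omega>. u\<^sup>2 * (1 + \<bar>u\<bar>) * ((w i \<omega> * e i \<omega>)\<^sup>2 * min 1 \<bar>w i \<omega> * e i \<omega>\<bar>) \<partial>M)"
    proof (rule integral_mono)
      fix \<omega>
      have "min 1 \<bar>u * (w i \<omega> * e i \<omega>)\<bar> \<le> (1 + \<bar>u\<bar>) * min 1 \<bar>w i \<omega> * e i \<omega>\<bar>"
        using min_1_mult_le[of "\<bar>u\<bar>" "\<bar>w i \<omega> * e i \<omega>\<bar>"] by (simp add: abs_mult)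
      then have "(u * (w i \<omega> * e i \<omega>))\<^sup>2 * min 1 \<bar>u * (w i \<omega> * e i \<omega>)\<bar>
        \<le> (u * (w i \<omega> * e i \<omega>))\<^sup>2 * ((1 + \<bar>u\<bar>) * min 1 \<bar>w i \<omega> * e i \<omega>\<bar>)"
        by (intro mult_left_mono) auto
      then show "(u * (w i \<omega> * e i \<omega>))\<^sup>2 * min 1 \<bar>u * (w i \<omega> * e i \<omega>)\<bar>
        \<le> u\<^sup>2 * (1 + \<bar>u\<bar>) * ((w i \<omega> * e i \<omega>)\<^sup>2 * min 1 \<bar>w i \<omega> * e i \<omega>\<bar>)"
        by (simp only: power_mult_distrib mult_ac)
    qed (use int[of u] int[of 1] in \<open>simp_all\<close>)
    also have "\<dots> = u\<^sup>2 * (1 + \<bar>u\<bar>) * L i" unfolding L_def by (rule integral_mult_right_zero)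
    finally show "(\<integral>\<omega>. (u * (w i \<omega> * e i \<omega>))\<^sup>2 * min 1 \<bar>u * (w i \<omega> * e i \<omega>)\<bar> \<partial>M) \<le> u\<^sup>2 * (1 + \<bar>u\<bar>) * L i" .
    have "(\<integral>\<omega>. (u * w i \<omega>) ^ 4 / 8 \<partial>M) = (\<integral>\<omega>. u ^ 4 / 8 * (w i \<omega>) ^ 4 \<partial>M)"
      by (simp add: power_mult_distrib)
    then show "(\<integral>\<omega>. (u * w i \<omega>) ^ 4 / 8 \<partial>M) \<le> u ^ 4 / 8 * (\<integral>\<omega>. (w i \<omega>) ^ 4 \<partial>M)"
      by (simp only: integral_mult_right_zero order_refl)
  qed (use E0 in simp)
  finally have 2: "cmod (J - 1) \<le> E * (u\<^sup>2 * (1 + \<bar>u\<bar>) * (\<Sum>i=1..n. L i) + u ^ 4 / 8 * (\<Sum>i=1..n. \<integral>\<omega>. (w i \<omega>) ^ 4 \<partial>M))"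
    by (simp only: sum.distrib sum_distrib_left)
  have "E * exp (- (u\<^sup>2 / 2)) = 1" by (simp add: E_def mult_exp_exp)
  then have "complex_of_real E * complex_of_real (exp (- (u\<^sup>2 / 2))) = 1" by (metis of_real_1 of_real_mult)
  then have "complex_of_real E * (I - complex_of_real (exp (- (u\<^sup>2 / 2)))) = (E * I - J) + (J - 1)"
    by (simp add: right_diff_distrib)
  then have "E * cmod (I - complex_of_real (exp (- (u\<^sup>2 / 2)))) = cmod ((E * I - J) + (J - 1))"
    using E0 by (metis abs_of_pos norm_mult norm_of_real)
  also have "\<dots> \<le> E * (u\<^sup>2 / 2 * (\<integral>\<omega>. 1 - V \<omega> \<partial>M)) + E * (u\<^sup>2 * (1 + \<bar>u\<bar>) * (\<Sum>i=1..n. L i) + u ^ 4 / 8 * (\<Sum>i=1..n. \<integral>\<omega>. (w i \<omega>) ^ 4 \<partial>M))"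
    by (rule order_trans[OF norm_triangle_ineq add_mono[OF 1 2]])
  also have "\<dots> = E * (u\<^sup>2 * (1 + \<bar>u\<bar>) * (\<Sum>i=1..n. L i) + u ^ 4 / 8 * (\<Sum>i=1..n. \<integral>\<omega>. (w i \<omega>) ^ 4 \<partial>M) + u\<^sup>2 / 2 * (\<integral>\<omega>. 1 - V \<omega> \<partial>M))"
    by (simp only: distrib_left add_ac)
  finally show ?thesis unfolding I_def S_def V_def L_def using E0 by (simp only: mult_le_cancel_left_pos)
qed

end

section \<open>Central limit theorem for predictable weights\<close>

text \<open>Levy continuity applied to \<open>char_weighted_sum\<close>: for fixed m the terms from
  \<open>b\<close> and from the missing squared weight vanish with n, and the rest vanishes with m.
  The common bound \<open>b\<close> tending to 0 takes the place of a Lindeberg condition on the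
  weights.\<close>

theorem weighted_sum_clt:
  assumes w_pred: "\<And>n t. t \<in> {1..n} \<Longrightarrow> w n t \<in> borel_measurable (F (t - 1))"
    and w_sum: "\<And>n \<omega>. \<omega> \<in> space M \<Longrightarrow> (\<Sum>t=1..n. (w n t \<omega>)\<^sup>2) \<le> 1"
    and b_meas [measurable]: "\<And>n. b n \<in> borel_measurable M"
    and w_b: "\<And>n t \<omega>. t \<in> {1..n} \<Longrightarrow> \<omega> \<in> space M \<Longrightarrow> \<bar>w n t \<omega>\<bar> \<le> b n \<omega>"
    and V: "conv_in_prob M (\<lambda>n \<omega>. \<Sum>t=1..n. (w n t \<omega>)\<^sup>2) 1"
    and b: "conv_in_prob M b 0"
  shows "weak_conv_m (\<lambda>n. distr M borel (\<lambda>\<omega>. \<Sum>t=1..n. w n t \<omega> * e t \<omega>)) std_normal_distribution"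
proof (rule levy_continuity[OF _ real_dist_normal_dist])
  have wM [measurable]: "w n t \<in> borel_measurable M" if "t \<in> {1..n}" for n t
    using measurable_F_M[OF w_pred[OF that]] .
  have S [measurable]: "(\<lambda>\<omega>. \<Sum>t=1..n. w n t \<omega> * e t \<omega>) \<in> borel_measurable M" for n
    by (rule borel_measurable_sum) (use wM e_measurable in measurable)
  have Vm [measurable]: "(\<lambda>\<omega>. \<Sum>t=1..n. (w n t \<omega>)\<^sup>2) \<in> borel_measurable M" for n
    by (rule borel_measurable_sum) (use wM in measurable)
  show "real_distribution (distr M borel (\<lambda>\<omega>. \<Sum>t=1..n. w n t \<omega> * e t \<omega>))" for n
    by (rule real_distribution_distr) (rule S)
  fix u
  define X where "X n = (\<integral>\<omega>. iexp (u * (\<Sum>t=1..n. w n t \<omega> * e t \<omega>)) \<partial>M)" for n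
  define G where "G = complex_of_real (exp (- (u\<^sup>2 / 2)))"
  define B where "B m n = prob {\<omega> \<in> space M. b n \<omega> > 1 / real (Suc m) ^ 4}" for m n
  define D where "D n = (\<integral>\<omega>. 1 - (\<Sum>t=1..n. (w n t \<omega>)\<^sup>2) \<partial>M)" for n
  define \<tau> where "\<tau> m = (\<integral>\<omega>. tail_bound (real (Suc m)) \<omega> \<partial>M)" for m
  have char: "char (distr M borel (\<lambda>\<omega>. \<Sum>t=1..n. w n t \<omega> * e t \<omega>)) u = X n" for n
    unfolding char_def X_def by (subst integral_distr) auto
  have B: "(\<lambda>n. B m n) \<longlonglongrightarrow> 0" for m
  proof (rule tendsto_sandwich[OF _ _ tendsto_const])
    show "(\<lambda>n. prob {\<omega> \<in> space M. \<bar>b n \<omega> - 0\<bar> > 1 / real (Suc m) ^ 4}) \<longlonglongrightarrow> 0"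
      using b[unfolded conv_in_prob_def, rule_format, of "1 / real (Suc m) ^ 4"] by simp
    show "\<forall>\<^sub>F n in sequentially. B m n \<le> prob {\<omega> \<in> space M. \<bar>b n \<omega> - 0\<bar> > 1 / real (Suc m) ^ 4}"
      unfolding B_def by (intro always_eventually allI finite_measure_mono) auto
  qed (simp add: B_def)
  have D: "D \<longlonglongrightarrow> 0" unfolding D_def
  proof (rule conv_in_prob_bounded_expectation[where K = 1])
    show "prob_space M" by (rule prob_space_axioms)
    show "conv_in_prob M (\<lambda>n \<omega>. 1 - (\<Sum>t=1..n. (w n t \<omega>)\<^sup>2)) 0"
      using V unfolding conv_in_prob_def by (simp add: abs_minus_commute)
  qed (use w_sum in \<open>auto simp: sum_nonneg\<close>)
  have bound: "\<bar>cmod (X n - G)\<bar> \<le> (u\<^sup>2 * (1 + \<bar>u\<bar>) * B m n + u ^ 4 / 8 * B m n + u\<^sup>2 / 2 * D n) +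
      (u\<^sup>2 * (1 + \<bar>u\<bar>) * \<tau> m + u ^ 4 / 8 * (1 / real (Suc m) ^ 4)\<^sup>2)" for n m
  proof -
    note asm = w_pred[of _ n] w_sum[of _ n] b_meas[of n] w_b[of _ n]
    have "cmod (X n - G) \<le> u\<^sup>2 * (1 + \<bar>u\<bar>) * (\<Sum>t=1..n. \<integral>\<omega>. (w n t \<omega> * e t \<omega>)\<^sup>2 * min 1 \<bar>w n t \<omega> * e t \<omega>\<bar> \<partial>M)
      + u ^ 4 / 8 * (\<Sum>t=1..n. \<integral>\<omega>. (w n t \<omega>) ^ 4 \<partial>M) + u\<^sup>2 / 2 * D n"
      unfolding X_def G_def D_def by (rule char_weighted_sum[OF asm])
    also have "\<dots> \<le> u\<^sup>2 * (1 + \<bar>u\<bar>) * (B m n + \<tau> m) + u ^ 4 / 8 * (B m n + (1 / real (Suc m) ^ 4)\<^sup>2) + u\<^sup>2 / 2 * D n"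
      unfolding B_def \<tau>_def
      by (intro add_mono mult_left_mono order_refl lindeberg_sum[OF asm] fourth_power_sum[OF asm]) auto
    finally show ?thesis by (simp only: distrib_left abs_norm_cancel add_ac)
  qed
  have "(\<lambda>n. cmod (X n - G)) \<longlonglongrightarrow> 0"
  proof (rule tendsto_zero_two_scale[OF bound])
    show "(\<lambda>n. u\<^sup>2 * (1 + \<bar>u\<bar>) * B m n + u ^ 4 / 8 * B m n + u\<^sup>2 / 2 * D n) \<longlonglongrightarrow> 0" for m
      using tendsto_add[OF tendsto_add[OF tendsto_mult_left[OF B] tendsto_mult_left[OF B]] tendsto_mult_left[OF D]]
      by (metis (no_types) add_0_right mult_zero_right)
    have "\<tau> \<longlonglongrightarrow> 0" unfolding \<tau>_def by (rule integral_tail_bound_tendsto)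
    moreover have "(\<lambda>m. (1 / real (Suc m) ^ 4)\<^sup>2) \<longlonglongrightarrow> 0\<^sup>2"
      using tendsto_power[OF LIMSEQ_Suc[OF lim_1_over_n[where 'a = real]], of 4]
      by (intro tendsto_power) (simp add: power_divide)
    ultimately have "(\<lambda>m. u\<^sup>2 * (1 + \<bar>u\<bar>) * \<tau> m + u ^ 4 / 8 * (1 / real (Suc m) ^ 4)\<^sup>2) \<longlonglongrightarrow> u\<^sup>2 * (1 + \<bar>u\<bar>) * 0 + u ^ 4 / 8 * 0\<^sup>2"
      by (intro tendsto_add tendsto_mult tendsto_const)
    then show "(\<lambda>m. u\<^sup>2 * (1 + \<bar>u\<bar>) * \<tau> m + u ^ 4 / 8 * (1 / real (Suc m) ^ 4)\<^sup>2) \<longlonglongrightarrow> 0" by simp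
  qed
  then have "X \<longlonglongrightarrow> G" using LIM_zero_iff tendsto_norm_zero_iff by blast
  then show "(\<lambda>n. char (distr M borel (\<lambda>\<omega>. \<Sum>t=1..n. w n t \<omega> * e t \<omega>)) u) \<longlonglongrightarrow> char std_normal_distribution u"
    unfolding char char_std_normal_distribution G_def by simp
qed

end

section \<open>The estimator\<close>

lemma axis_component_sq: "\<exists>j. v = axis j 1 \<Longrightarrow> ((v :: real ^ 'k) $ k)\<^sup>2 = 0 \<or> (v $ k)\<^sup>2 = 1"
  by (auto simp: axis_def)

lemma alee_s_ratio_ge_1: "s0 \<omega> > 0 \<Longrightarrow> 1 \<le> alee_s s0 x t k \<omega> / s0 \<omega>"
  by (simp add: alee_s_def sum_nonneg)

lemma alee_w_abs_le:
  assumes "\<beta> > 0" "s0 \<omega> > 0" and x: "\<exists>j. x t \<omega> = axis j 1"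
  shows "\<bar>alee_w \<beta> s0 x t \<omega> $ k\<bar> \<le> alee_f \<beta> 1 / sqrt (s0 \<omega>)"
proof -
  have r: "1 \<le> alee_s s0 x t k \<omega> / s0 \<omega>" using alee_s_ratio_ge_1 assms(2) .
  have f: "0 \<le> alee_f \<beta> (alee_s s0 x t k \<omega> / s0 \<omega>)" "alee_f \<beta> (alee_s s0 x t k \<omega> / s0 \<omega>) \<le> alee_f \<beta> 1"
    using alee_f_pos[of "alee_s s0 x t k \<omega> / s0 \<omega>" \<beta>] alee_f_antimono[OF assms(1) order_refl r] r assms(1)
    by linarith+
  have "\<bar>x t \<omega> $ k\<bar> \<le> 1" using x by (auto simp: axis_def)
  then have "\<bar>x t \<omega> $ k / sqrt (s0 \<omega>)\<bar> \<le> 1 / sqrt (s0 \<omega>)"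
    using assms(2) by (simp add: abs_divide divide_right_mono)
  then have "alee_f \<beta> (alee_s s0 x t k \<omega> / s0 \<omega>) * \<bar>x t \<omega> $ k / sqrt (s0 \<omega>)\<bar> \<le> alee_f \<beta> 1 * (1 / sqrt (s0 \<omega>))"
    using f assms(2) by (intro mult_mono) auto
  then show ?thesis using f by (simp add: alee_w_def abs_mult)
qed

text \<open>The primitive of f^2 runs from -1 to a nonpositive value, which gives the upper bound.
  The two defects in the lower bound are the part of the integral beyond the final ratio and the
  mesh error; they vanish as the ratio and \<open>s0\<close> grow.\<close>

lemma alee_w_sq_sum:
  assumes \<beta>: "\<beta> > 0" and s0: "s0 \<omega> > 0" and x: "\<And>t. t \<ge> 1 \<Longrightarrow> \<exists>j. x t \<omega> = axis j 1"
  shows "(\<Sum>t=1..n. (alee_w \<beta> s0 x t \<omega> $ k)\<^sup>2) \<le> 1"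
    and "1 - ln 2 powr \<beta> * ln (2 + ln (alee_s s0 x n k \<omega> / s0 \<omega>)) powr (- \<beta>) - (alee_f \<beta> 1)\<^sup>2 / s0 \<omega>
      \<le> (\<Sum>t=1..n. (alee_w \<beta> s0 x t \<omega> $ k)\<^sup>2)"
proof -
  define r where "r t = alee_s s0 x t k \<omega> / s0 \<omega>" for t
  let ?\<Phi> = "\<lambda>z. - (ln 2 powr \<beta>) * ln (2 + ln z) powr (- \<beta>)"
  have eq: "(alee_w \<beta> s0 x t \<omega> $ k)\<^sup>2 = (alee_f \<beta> (r t))\<^sup>2 * ((x t \<omega> $ k)\<^sup>2 / s0 \<omega>)" for t
    using s0 by (simp add: alee_w_def r_def power_mult_distrib power_divide)
  have anti: "(alee_f \<beta> b)\<^sup>2 \<le> (alee_f \<beta> a)\<^sup>2" if "1 \<le> a" "a \<le> b" for a b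
    using alee_f_antimono[OF \<beta> that] alee_f_pos[of b \<beta>] that \<beta> by (intro power_mono) auto
  have deriv: "(?\<Phi> has_real_derivative (alee_f \<beta> z)\<^sup>2) (at z)" if "z \<ge> 1" for z
    using that \<beta> by (intro DERIV_alee_f_sq_primitive) auto
  have d: "(x t \<omega> $ k)\<^sup>2 = 0 \<or> (x t \<omega> $ k)\<^sup>2 = 1" if "t \<ge> 1" for t
    by (rule axis_component_sq[OF x[OF that]])
  note bounds = antimono_sum_bounds[of "s0 \<omega>" "\<lambda>z. (alee_f \<beta> z)\<^sup>2" ?\<Phi> "\<lambda>t. (x t \<omega> $ k)\<^sup>2" n,
    OF s0 anti deriv d, folded alee_s_def, folded r_def, folded eq]
  have "ln 2 powr \<beta> * ln 2 powr (- \<beta>) = (1::real)" by (simp add: powr_minus)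
  then have \<Phi>1: "?\<Phi> 1 = - 1" by simp
  have \<Phi>0: "?\<Phi> (r n) \<le> 0" by simp
  show "(\<Sum>t=1..n. (alee_w \<beta> s0 x t \<omega> $ k)\<^sup>2) \<le> 1"
    using bounds(1) \<Phi>1 \<Phi>0 by linarith
  have "0 \<le> (alee_f \<beta> (r n))\<^sup>2 / s0 \<omega>" using s0 by simp
  then show "1 - ln 2 powr \<beta> * ln (2 + ln (alee_s s0 x n k \<omega> / s0 \<omega>)) powr (- \<beta>) - (alee_f \<beta> 1)\<^sup>2 / s0 \<omega>
      \<le> (\<Sum>t=1..n. (alee_w \<beta> s0 x t \<omega> $ k)\<^sup>2)"
    using bounds(2) \<Phi>1 unfolding r_def[symmetric] diff_divide_distrib by simp
qed

text \<open>The extra 1 / sqrt \<open>s0\<close> completes the mesh: weight times \<open>x\<close>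
  becomes f times the squared component over \<open>s0\<close>, a Riemann sum of f itself.\<close>

lemma alee_w_x_sum:
  assumes \<beta>: "\<beta> > 0" and s0: "s0 \<omega> > 0" and x: "\<And>t. t \<ge> 1 \<Longrightarrow> \<exists>j. x t \<omega> = axis j 1"
    and G: "\<And>z. z \<ge> 1 \<Longrightarrow> (G has_real_derivative alee_f \<beta> z) (at z)"
  shows "(\<Sum>t=1..n. alee_w \<beta> s0 x t \<omega> $ k * x t \<omega> $ k) / sqrt (s0 \<omega>) \<le> G (alee_s s0 x n k \<omega> / s0 \<omega>) - G 1"
    and "G (alee_s s0 x n k \<omega> / s0 \<omega>) - G 1 - alee_f \<beta> 1 / s0 \<omega>
      \<le> (\<Sum>t=1..n. alee_w \<beta> s0 x t \<omega> $ k * x t \<omega> $ k) / sqrt (s0 \<omega>)"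
proof -
  define r where "r t = alee_s s0 x t k \<omega> / s0 \<omega>" for t
  have "alee_w \<beta> s0 x t \<omega> $ k * x t \<omega> $ k / sqrt (s0 \<omega>) = alee_f \<beta> (r t) * ((x t \<omega> $ k)\<^sup>2 / s0 \<omega>)" for t
    using s0 by (simp add: alee_w_def r_def power2_eq_square)
  then have eq: "(\<Sum>t=1..n. alee_w \<beta> s0 x t \<omega> $ k * x t \<omega> $ k) / sqrt (s0 \<omega>) = (\<Sum>t=1..n. alee_f \<beta> (r t) * ((x t \<omega> $ k)\<^sup>2 / s0 \<omega>))"
    by (simp add: sum_divide_distrib)
  have d: "(x t \<omega> $ k)\<^sup>2 = 0 \<or> (x t \<omega> $ k)\<^sup>2 = 1" if "t \<ge> 1" for t
    by (rule axis_component_sq[OF x[OF that]])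
  note bounds = antimono_sum_bounds[of "s0 \<omega>" "alee_f \<beta>" G "\<lambda>t. (x t \<omega> $ k)\<^sup>2" n,
    OF s0 alee_f_antimono[OF \<beta>] G d, folded alee_s_def, folded r_def, folded eq]
  show "(\<Sum>t=1..n. alee_w \<beta> s0 x t \<omega> $ k * x t \<omega> $ k) / sqrt (s0 \<omega>) \<le> G (alee_s s0 x n k \<omega> / s0 \<omega>) - G 1"
    using bounds(1) by (simp add: r_def)
  have "1 \<le> r n" unfolding r_def using s0 by (rule alee_s_ratio_ge_1)
  then have "0 \<le> alee_f \<beta> (r n) / s0 \<omega>" using s0 alee_f_pos[of "r n" \<beta>] \<beta> by simp
  then show "G (alee_s s0 x n k \<omega> / s0 \<omega>) - G 1 - alee_f \<beta> 1 / s0 \<omega>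
      \<le> (\<Sum>t=1..n. alee_w \<beta> s0 x t \<omega> $ k * x t \<omega> $ k) / sqrt (s0 \<omega>)"
    using bounds(2) unfolding r_def[symmetric] diff_divide_distrib by simp
qed

text \<open>The vector equation decouples: in each round either arm \<open>k\<close> is pulled and
  the inner product is the \<open>k\<close>-th coordinate, or the \<open>k\<close>-th weight is
  0.\<close>

lemma alee_error_identity:
  fixes x :: "nat \<Rightarrow> 'a \<Rightarrow> real ^ 'k"
  assumes x: "\<And>t. t \<ge> 1 \<Longrightarrow> \<exists>j. x t \<omega> = axis j 1"
    and y: "\<And>t. t \<ge> 1 \<Longrightarrow> y t \<omega> = x t \<omega> \<bullet> \<theta> + \<epsilon> t \<omega>"
    and alee: "is_ALEE (alee_w \<beta> s0 x) x y n \<omega> \<theta>'"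
  shows "(\<Sum>t=1..n. alee_w \<beta> s0 x t \<omega> $ k * \<epsilon> t \<omega>)
    = (\<theta>' $ k - \<theta> $ k) * (\<Sum>t=1..n. alee_w \<beta> s0 x t \<omega> $ k * x t \<omega> $ k)"
proof -
  have "(\<Sum>t=1..n. (y t \<omega> - x t \<omega> \<bullet> \<theta>') * alee_w \<beta> s0 x t \<omega> $ k) = 0"
    using arg_cong[OF alee[unfolded is_ALEE_def], of "\<lambda>v. v $ k"] by simp
  moreover have "(y t \<omega> - x t \<omega> \<bullet> \<theta>') * alee_w \<beta> s0 x t \<omega> $ k
      = alee_w \<beta> s0 x t \<omega> $ k * \<epsilon> t \<omega> - (\<theta>' $ k - \<theta> $ k) * (alee_w \<beta> s0 x t \<omega> $ k * x t \<omega> $ k)"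
    if "t \<in> {1..n}" for t
  proof -
    have t: "t \<ge> 1" using that by simp
    obtain j where j: "x t \<omega> = axis j 1" using x[OF t] by blast
    show ?thesis
    proof (cases "j = k")
      case True
      then show ?thesis using y[OF t] j by (simp add: inner_axis' algebra_simps)
    next
      case False
      then have "alee_w \<beta> s0 x t \<omega> $ k = 0" using j by (simp add: alee_w_def axis_def)
      then show ?thesis by simp
    qed
  qed
  ultimately show ?thesis by (simp add: sum_subtractf sum_distrib_left)
qed

section \<open>Measurability of weights and history\<close>

lemma borel_measurable_vec_nth:
  fixes f :: "'a \<Rightarrow> real ^ 'k"
  assumes "f \<in> borel_measurable N"
  shows "(\<lambda>\<omega>. f \<omega> $ k) \<in> borel_measurable N"
  by (rule borel_measurable_continuous_on[OF _ assms]) (intro continuous_intros)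

lemma alee_f_measurable [measurable]: "alee_f \<beta> \<in> borel_measurable borel"
  unfolding alee_f_def by measurable

lemma alee_scale_measurable [measurable]: "alee_scale \<beta> \<in> borel_measurable borel"
  unfolding alee_scale_def by measurable

lemma alee_s_measurable:
  fixes x :: "nat \<Rightarrow> 'a \<Rightarrow> real ^ 'k"
  assumes [measurable]: "s0 \<in> borel_measurable N" and "\<And>i. i \<in> {1..t} \<Longrightarrow> x i \<in> borel_measurable N"
  shows "alee_s s0 x t k \<in> borel_measurable N"
proof -
  have "(\<lambda>\<omega>. \<Sum>i=1..t. (x i \<omega> $ k)\<^sup>2) \<in> borel_measurable N"
    using assms(2) by (intro borel_measurable_sum borel_measurable_power borel_measurable_vec_nth) auto
  then show ?thesis unfolding alee_s_def by measurable
qed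

text \<open>The weight of round \<open>t\<close> uses \<open>x t\<close> itself, also through
  \<open>alee_s\<close>; predictability therefore rests on \<open>x t\<close> being known before the
  noise of that round.\<close>

lemma alee_w_measurable:
  fixes x :: "nat \<Rightarrow> 'a \<Rightarrow> real ^ 'k"
  assumes [measurable]: "s0 \<in> borel_measurable N" and x: "\<And>i. i \<in> {1..t} \<Longrightarrow> x i \<in> borel_measurable N" and "t \<ge> 1"
  shows "(\<lambda>\<omega>. alee_w \<beta> s0 x t \<omega> $ k) \<in> borel_measurable N"
proof -
  note [measurable] = alee_s_measurable[OF assms(1) x]
  have [measurable]: "(\<lambda>\<omega>. x t \<omega> $ k) \<in> borel_measurable N"
    using x[of t] \<open>t \<ge> 1\<close> by (intro borel_measurable_vec_nth) auto
  show ?thesis unfolding alee_w_def by simp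
qed

lemma history_algebra_measurable:
  fixes x :: "nat \<Rightarrow> 'a \<Rightarrow> real ^ 'k"
  assumes "subalgebra N (history_algebra M x y t)"
  shows "i \<in> {1..t} \<Longrightarrow> x i \<in> borel_measurable N" and "i \<in> {1..<t} \<Longrightarrow> y i \<in> borel_measurable N"
proof -
  let ?A = "{x i -` A \<inter> space M | i A. i \<in> {1..t} \<and> A \<in> sets borel} \<union>
      {y i -` B \<inter> space M | i B. i \<in> {1..<t} \<and> B \<in> sets borel}"
  have A: "?A \<subseteq> Pow (space M)" by auto
  have sp: "space N = space M"
    using assms A by (simp add: subalgebra_def history_algebra_def space_measure_of)
  have sub: "?A \<subseteq> sets N"
  proof -
    have "sets (history_algebra M x y t) = sigma_sets (space M) ?A"
      unfolding history_algebra_def by (rule sets_measure_of[OF A])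
    then have "sigma_sets (space M) ?A \<subseteq> sets N" using assms unfolding subalgebra_def by simp
    then show ?thesis using sigma_sets_superset_generator[of ?A "space M"] by (rule order_trans[rotated])
  qed
  show "x i \<in> borel_measurable N" if "i \<in> {1..t}"
  proof (rule measurableI)
    fix A :: "(real ^ 'k) set" assume "A \<in> sets borel"
    then have "x i -` A \<inter> space M \<in> ?A" using that by blast
    then show "x i -` A \<inter> space N \<in> sets N" unfolding sp by (rule subsetD[OF sub])
  qed simp
  show "y i \<in> borel_measurable N" if "i \<in> {1..<t}"
  proof (rule measurableI)
    fix B :: "real set" assume "B \<in> sets borel"
    then have "y i -` B \<inter> space M \<in> ?A" using that by blast
    then show "y i -` B \<inter> space N \<in> sets N" unfolding sp by (rule subsetD[OF sub])
  qed simp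
qed

section \<open>Transfer of the Gaussian limit to the studentized arm mean\<close>

theorem corollary3p2:
  fixes M :: "'a measure"
    and F :: "nat \<Rightarrow> 'a measure"
    and x :: "nat \<Rightarrow> 'a \<Rightarrow> real ^ 'k"
    and y \<epsilon> :: "nat \<Rightarrow> 'a \<Rightarrow> real"
    and \<theta> :: "real ^ 'k"
    and \<sigma> \<delta> \<beta> :: real
    and s0 :: "nat \<Rightarrow> 'a \<Rightarrow> real"
    and \<theta>_hat :: "nat \<Rightarrow> 'a \<Rightarrow> real ^ 'k"
    and \<sigma>_hat :: "nat \<Rightarrow> 'a \<Rightarrow> real"
    and k :: 'k
  assumes "prob_space M"
    and "\<sigma> > 0" and "\<delta> > 0" and "\<beta> > 0"
    and "filtration (space M) F"
    and "\<And>t. subalgebra M (F t)"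
    and "\<And>t. t \<ge> 1 \<Longrightarrow> subalgebra (F (t - 1)) (history_algebra M x y t)"
    and "\<And>t \<omega>. t \<ge> 1 \<Longrightarrow> \<omega> \<in> space M \<Longrightarrow> \<exists>j. x t \<omega> = axis j 1"
    and "\<And>t \<omega>. t \<ge> 1 \<Longrightarrow> \<omega> \<in> space M \<Longrightarrow> y t \<omega> = x t \<omega> \<bullet> \<theta> + \<epsilon> t \<omega>"
    and "\<And>t. t \<ge> 1 \<Longrightarrow> AE \<omega> in M. real_cond_exp M (F (t - 1)) (\<epsilon> t) \<omega> = 0"
    and "\<And>t. t \<ge> 1 \<Longrightarrow> AE \<omega> in M. real_cond_exp M (F (t - 1)) (\<lambda>\<omega>. (\<epsilon> t \<omega>)\<^sup>2) \<omega> = \<sigma>\<^sup>2"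
    and "AE \<omega> in M. (SUP t\<in>{1..}. nn_cond_exp M (F (t - 1))
            (\<lambda>\<omega>. ennreal (\<bar>\<epsilon> t \<omega> / \<sigma>\<bar> powr (2 + \<delta>))) \<omega>) < \<infinity>"
    and "\<And>n. s0 n \<in> borel_measurable (F 0)"
    and "\<And>n \<omega>. \<omega> \<in> space M \<Longrightarrow> s0 n \<omega> > 0"
    and "conv_in_prob M (\<lambda>n \<omega>. 1 / s0 n \<omega> + s0 n \<omega> / alee_s (s0 n) x n k \<omega>) 0"
    and "\<And>n. \<theta>_hat n \<in> borel_measurable M"
    and "\<And>n \<omega>. \<omega> \<in> space M \<Longrightarrow> is_ALEE (alee_w \<beta> (s0 n) x) x y n \<omega> (\<theta>_hat n \<omega>)"
    and "\<And>n. \<sigma>_hat n \<in> borel_measurable M"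
    and "conv_in_prob M \<sigma>_hat \<sigma>"
  shows "weak_conv_m
     (\<lambda>n. distr M borel (\<lambda>\<omega>.
        sqrt (4 * \<beta> * ln 2 powr \<beta> /
              (ln (alee_s (s0 n) x n k \<omega> / s0 n \<omega>) *
               ln (ln (alee_s (s0 n) x n k \<omega> / s0 n \<omega>)) powr (1 + \<beta>))) *
        (sqrt (alee_s (s0 n) x n k \<omega>) * (\<theta>_hat n \<omega> $ k - \<theta> $ k) / \<sigma>_hat n \<omega>)))
     std_normal_distribution"
proof -
  interpret prob_space M by fact
  note x_axis = assms(8) and y_eq = assms(9) and s0_pos = assms(14)
  have filt: "filtration (space M) F" and subalg: "\<And>t. subalgebra M (F t)" by fact+
  have F_mono: "subalgebra (F t) (F s)" if "s \<le> t" for s t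
    using filtration.sets_F_mono[OF filt that] filtration.space_F[OF filt] by (simp add: subalgebra_def)
  \<comment> \<open>The history at round \<open>Suc t\<close> contains \<open>x\<close> up to
    \<open>Suc t\<close> but \<open>y\<close> only up to \<open>t\<close>, so \<open>F t\<close>
    knows the arms one step ahead of the responses.\<close>
  have x_meas: "x i \<in> borel_measurable (F t)" if "i \<in> {1..Suc t}" for i t
    using history_algebra_measurable(1)[OF assms(7)[of "Suc t"]] that by simp
  have y_meas: "y i \<in> borel_measurable (F i)" if "i \<ge> 1" for i
    using history_algebra_measurable(2)[OF assms(7)[of "Suc i"]] that by simp
  \<comment> \<open>The noise inherits adaptedness from the model equation.\<close>
  have noise_meas: "\<epsilon> t \<in> borel_measurable (F t)" if t: "t \<ge> 1" for t
  proof -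
    have [measurable]: "x t \<in> borel_measurable (F t)" "y t \<in> borel_measurable (F t)"
      using x_meas y_meas t by auto
    have "(\<lambda>\<omega>. y t \<omega> - x t \<omega> \<bullet> \<theta>) \<in> borel_measurable (F t)" by measurable
    moreover have "y t \<omega> - x t \<omega> \<bullet> \<theta> = \<epsilon> t \<omega>" if "\<omega> \<in> space (F t)" for \<omega>
      using y_eq[OF t, of \<omega>] that filtration.space_F[OF filt] by simp
    ultimately show ?thesis by (simp cong: measurable_cong)
  qed
  have noise_M [measurable]: "\<epsilon> t \<in> borel_measurable M" if "t \<ge> 1" for t
    using measurable_from_subalg[OF subalg noise_meas[OF that]] .
  have fms: "finite_measure_subalgebra M (F t)" for t
    using subalg by (intro finite_measure_subalgebra.intro finite_measure_subalgebra_axioms.intro finite_measure_axioms)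
  \<comment> \<open>The rule that takes the scaling by sigma out of \<open>real_cond_exp\<close>
    asks for integrability, which the positive conditional variance provides.\<close>
  have int_sq: "integrable M (\<lambda>\<omega>. (\<epsilon> t \<omega>)\<^sup>2)" if t: "t \<ge> 1" for t
    by (rule finite_measure_subalgebra.integrable_of_real_cond_exp_eq[OF fms, of _ "\<sigma>\<^sup>2"])
      (use assms(2) assms(11)[OF t] noise_M[OF t] in auto)
  have int: "integrable M (\<epsilon> t)" if t: "t \<ge> 1" for t
    using square_integrable_imp_integrable[OF noise_M[OF t] int_sq[OF t]] .
  interpret unit_noise M F "\<lambda>t \<omega>. \<epsilon> t \<omega> / \<sigma>" \<delta>
  proof
    show "\<delta> > 0" by fact
    show "subalgebra M (F t)" for t by fact
    show "subalgebra (F t) (F s)" if "s \<le> t" for s t using F_mono that .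
    fix t :: nat assume t: "t \<ge> 1"
    interpret finite_measure_subalgebra M "F (t - 1)" by (rule fms)
    show "(\<lambda>\<omega>. \<epsilon> t \<omega> / \<sigma>) \<in> borel_measurable (F t)" using noise_meas[OF t] by simp
    show "AE \<omega> in M. real_cond_exp M (F (t - 1)) (\<lambda>\<omega>. \<epsilon> t \<omega> / \<sigma>) \<omega> = 0"
      using real_cond_exp_cdiv[OF int[OF t], of \<sigma>] assms(10)[OF t] by eventually_elim simp
    have "AE \<omega> in M. real_cond_exp M (F (t - 1)) (\<lambda>\<omega>. (\<epsilon> t \<omega>)\<^sup>2 / \<sigma>\<^sup>2) \<omega> = 1"
      using real_cond_exp_cdiv[OF int_sq[OF t], of "\<sigma>\<^sup>2"] assms(11)[OF t]
      by eventually_elim (use assms(2) in simp)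
    then show "AE \<omega> in M. real_cond_exp M (F (t - 1)) (\<lambda>\<omega>. (\<epsilon> t \<omega> / \<sigma>)\<^sup>2) \<omega> = 1"
      by (simp add: power_divide)
  next
    show "AE \<omega> in M. (SUP t\<in>{1..}. nn_cond_exp M (F (t - 1))
      (\<lambda>\<omega>. ennreal (\<bar>\<epsilon> t \<omega> / \<sigma>\<bar> powr (2 + \<delta>))) \<omega>) < \<infinity>" by fact
  qed

  define w where "w n t \<omega> = alee_w \<beta> (s0 n) x t \<omega> $ k" for n t \<omega>
  define r where "r n \<omega> = alee_s (s0 n) x n k \<omega> / s0 n \<omega>" for n \<omega>
  define Y where "Y n \<omega> = 1 / s0 n \<omega> + s0 n \<omega> / alee_s (s0 n) x n k \<omega>" for n \<omega>
  define b where "b n \<omega> = alee_f \<beta> 1 / sqrt (s0 n \<omega>)" for n \<omega>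
  define S where "S n \<omega> = (\<Sum>t=1..n. w n t \<omega> * (\<epsilon> t \<omega> / \<sigma>))" for n \<omega>
  \<comment> \<open>The coefficient of the estimation error in the estimating equation, divided by
    sqrt \<open>s0\<close>.\<close>
  define D where "D n \<omega> = (\<Sum>t=1..n. w n t \<omega> * x t \<omega> $ k) / sqrt (s0 n \<omega>)" for n \<omega>
  define T where "T n \<omega> = sqrt (4 * \<beta> * ln 2 powr \<beta> /
              (ln (alee_s (s0 n) x n k \<omega> / s0 n \<omega>) *
               ln (ln (alee_s (s0 n) x n k \<omega> / s0 n \<omega>)) powr (1 + \<beta>))) *
        (sqrt (alee_s (s0 n) x n k \<omega>) * (\<theta>_hat n \<omega> $ k - \<theta> $ k) / \<sigma>_hat n \<omega>)" for n \<omega>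
  have f1: "0 < alee_f \<beta> 1" using assms(4) by (intro alee_f_pos) auto

  have s0_F: "s0 n \<in> borel_measurable (F t)" for n t
    by (rule measurable_F_mono[OF le0 assms(13)])
  have w_pred: "w n t \<in> borel_measurable (F (t - 1))" if "t \<in> {1..n}" for n t
    unfolding w_def using that by (intro alee_w_measurable s0_F x_meas) auto
  have [measurable]: "s0 n \<in> borel_measurable M" for n using measurable_F_M[OF s0_F[of n 0]] .
  have xM: "x i \<in> borel_measurable M" if "i \<ge> 1" for i
    using measurable_F_M[OF x_meas[of i i]] that by simp
  have [measurable]: "alee_s (s0 n) x n k \<in> borel_measurable M" for n
    by (rule alee_s_measurable) (use xM in auto)
  have [measurable]: "\<theta>_hat n \<in> borel_measurable M" "\<sigma>_hat n \<in> borel_measurable M" for n by fact+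
  have [measurable]: "(\<lambda>\<omega>. \<theta>_hat n \<omega> $ k) \<in> borel_measurable M" for n
    by (rule borel_measurable_vec_nth) measurable
  have [measurable]: "r n \<in> borel_measurable M" "Y n \<in> borel_measurable M" "b n \<in> borel_measurable M"
    "T n \<in> borel_measurable M" for n
    unfolding r_def Y_def b_def T_def by measurable
  have wM: "w n t \<in> borel_measurable M" if "t \<in> {1..n}" for n t
    using measurable_F_M[OF w_pred[OF that]] .
  have [measurable]: "S n \<in> borel_measurable M" for n
    unfolding S_def using wM noise_M
    by (intro borel_measurable_sum borel_measurable_times borel_measurable_divide) auto
  have "(\<lambda>\<omega>. \<Sum>t=1..n. w n t \<omega> * x t \<omega> $ k) \<in> borel_measurable M" for n
    using wM xM by (intro borel_measurable_sum borel_measurable_times borel_measurable_vec_nth) auto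
  then have [measurable]: "D n \<in> borel_measurable M" for n unfolding D_def by measurable

  have Y_conv: "conv_in_prob M Y 0" unfolding Y_def by fact
  have r_ge_1: "1 \<le> r n \<omega>" if "\<omega> \<in> space M" for n \<omega>
    unfolding r_def using s0_pos[OF that] by (rule alee_s_ratio_ge_1)
  \<comment> \<open>Both summands of \<open>Y\<close> are positive, so a small sum makes each of
    them small.\<close>
  have Y_small: "1 / s0 n \<omega> \<le> d \<and> 1 / d \<le> r n \<omega>"
    if "\<omega> \<in> space M" "d > 0" "\<not> \<bar>Y n \<omega> - 0\<bar> > d" for n \<omega> d
  proof -
    have s0: "0 < s0 n \<omega>" using s0_pos that by simp
    have r: "0 < r n \<omega>" using r_ge_1[OF that(1), of n] by linarith
    have "Y n \<omega> = 1 / s0 n \<omega> + 1 / r n \<omega>" by (simp add: Y_def r_def)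
    moreover have "0 < 1 / s0 n \<omega>" "0 < 1 / r n \<omega>" using s0 r by simp_all
    ultimately have "1 / s0 n \<omega> \<le> d" "1 / r n \<omega> \<le> d" using that(3) by linarith+
    then show ?thesis using r that(2) by (simp add: field_simps)
  qed
  \<comment> \<open>Reduces each remaining limit in probability to a deterministic statement about
    large \<open>s0\<close> and large ratio.\<close>
  have eventually_conv: "conv_in_prob M X c"
    if "\<And>\<epsilon>. \<epsilon> > 0 \<Longrightarrow> \<exists>d>0. \<forall>n. \<forall>\<omega>\<in>space M. 1 / s0 n \<omega> \<le> d \<longrightarrow> 1 / d \<le> r n \<omega> \<longrightarrow> \<bar>X n \<omega> - c\<bar> \<le> \<epsilon>" for X c
  proof (rule conv_in_prob_le[OF assms(1) Y_conv])
    fix \<epsilon> :: real assume "\<epsilon> > 0"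
    from that[OF this] obtain d where "d > 0"
      and d: "\<And>n \<omega>. \<omega> \<in> space M \<Longrightarrow> 1 / s0 n \<omega> \<le> d \<Longrightarrow> 1 / d \<le> r n \<omega> \<Longrightarrow> \<bar>X n \<omega> - c\<bar> \<le> \<epsilon>" by blast
    then show "\<exists>d>0. \<forall>n. \<forall>\<omega>\<in>space M. \<bar>X n \<omega> - c\<bar> > \<epsilon> \<longrightarrow> \<bar>Y n \<omega> - 0\<bar> > d"
      using Y_small by (meson not_less)
  qed measurable

  have w_sum: "(\<Sum>t=1..n. (w n t \<omega>)\<^sup>2) \<le> 1" if "\<omega> \<in> space M" for n \<omega>
    unfolding w_def using assms(4) s0_pos[OF that] x_axis[OF _ that] by (rule alee_w_sq_sum(1))
  have w_b: "\<bar>w n t \<omega>\<bar> \<le> b n \<omega>" if "t \<in> {1..n}" "\<omega> \<in> space M" for n t \<omega>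
    unfolding w_def b_def by (rule alee_w_abs_le) (use assms(4) s0_pos x_axis that in auto)
  have b_conv: "conv_in_prob M b 0"
  proof (rule eventually_conv)
    fix \<epsilon> :: real assume \<epsilon>: "\<epsilon> > 0"
    have "\<bar>b n \<omega> - 0\<bar> \<le> \<epsilon>" if "\<omega> \<in> space M" "1 / s0 n \<omega> \<le> (\<epsilon> / alee_f \<beta> 1)\<^sup>2" for n \<omega>
    proof -
      have "sqrt (1 / s0 n \<omega>) \<le> sqrt ((\<epsilon> / alee_f \<beta> 1)\<^sup>2)" using that by (simp only: real_sqrt_le_iff)
      also have "\<dots> = \<epsilon> / alee_f \<beta> 1" using \<epsilon> f1 by simp
      finally have "alee_f \<beta> 1 * sqrt (1 / s0 n \<omega>) \<le> \<epsilon>" using f1 by (simp add: field_simps)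
      then show ?thesis using f1 s0_pos[OF that(1), of n] by (simp add: b_def real_sqrt_divide)
    qed
    then show "\<exists>d>0. \<forall>n. \<forall>\<omega>\<in>space M. 1 / s0 n \<omega> \<le> d \<longrightarrow> 1 / d \<le> r n \<omega> \<longrightarrow> \<bar>b n \<omega> - 0\<bar> \<le> \<epsilon>"
      using \<epsilon> f1 by (intro exI[of _ "(\<epsilon> / alee_f \<beta> 1)\<^sup>2"]) auto
  qed
  have V_conv: "conv_in_prob M (\<lambda>n \<omega>. \<Sum>t=1..n. (w n t \<omega>)\<^sup>2) 1"
  proof (rule eventually_conv)
    fix \<epsilon> :: real assume \<epsilon>: "\<epsilon> > 0"
    have "((\<lambda>z. ln 2 powr \<beta> * ln (2 + ln z) powr (- \<beta>)) \<longlongrightarrow> ln 2 powr \<beta> * 0) at_top"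
    proof (intro tendsto_mult tendsto_const tendsto_neg_powr)
      show "filterlim (\<lambda>z::real. ln (2 + ln z)) at_top at_top" by real_asymp
    qed (use assms(4) in simp)
    then have "\<forall>\<^sub>F z in at_top. ln 2 powr \<beta> * ln (2 + ln z) powr (- \<beta>) < \<epsilon> / 2"
      using \<epsilon> by (intro order_tendstoD(2)) auto
    then obtain R where R: "\<And>z. z \<ge> R \<Longrightarrow> ln 2 powr \<beta> * ln (2 + ln z) powr (- \<beta>) < \<epsilon> / 2"
      unfolding eventually_at_top_linorder by blast
    \<comment> \<open>The first entry forces the ratio beyond \<open>R\<close>, the second bounds
      the mesh error; each defect then costs at most half of epsilon.\<close>
    define d where "d = min (1 / max 1 R) (\<epsilon> / (2 * (alee_f \<beta> 1)\<^sup>2))"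
    have d: "d > 0" "d * (alee_f \<beta> 1)\<^sup>2 \<le> \<epsilon> / 2"
    proof -
      show "d > 0" using \<epsilon> f1 by (simp add: d_def)
      have "d * (alee_f \<beta> 1)\<^sup>2 \<le> \<epsilon> / (2 * (alee_f \<beta> 1)\<^sup>2) * (alee_f \<beta> 1)\<^sup>2"
        by (intro mult_right_mono) (auto simp: d_def)
      then show "d * (alee_f \<beta> 1)\<^sup>2 \<le> \<epsilon> / 2" using f1 by simp
    qed
    have "d \<le> 1 / max 1 R" by (simp add: d_def)
    then have "1 / (1 / max 1 R) \<le> 1 / d" using d(1) by (intro divide_left_mono) auto
    then have dR: "R \<le> 1 / d" by simp
    have "\<bar>(\<Sum>t=1..n. (w n t \<omega>)\<^sup>2) - 1\<bar> \<le> \<epsilon>"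
      if \<omega>: "\<omega> \<in> space M" and s: "1 / s0 n \<omega> \<le> d" and rd: "1 / d \<le> r n \<omega>" for n \<omega>
    proof -
      have "1 - ln 2 powr \<beta> * ln (2 + ln (r n \<omega>)) powr (- \<beta>) - (alee_f \<beta> 1)\<^sup>2 / s0 n \<omega> \<le> (\<Sum>t=1..n. (w n t \<omega>)\<^sup>2)"
        unfolding w_def r_def using assms(4) s0_pos[OF \<omega>] x_axis[OF _ \<omega>] by (rule alee_w_sq_sum(2))
      moreover have "(alee_f \<beta> 1)\<^sup>2 / s0 n \<omega> \<le> \<epsilon> / 2"
        using order_trans[OF mult_right_mono[OF s, of "(alee_f \<beta> 1)\<^sup>2"] d(2)]
        by (simp only: zero_le_power2 times_divide_eq_left mult_1_left)
      moreover have "ln 2 powr \<beta> * ln (2 + ln (r n \<omega>)) powr (- \<beta>) < \<epsilon> / 2"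
        using R dR rd by simp
      ultimately show ?thesis using w_sum[OF \<omega>, of n] by linarith
    qed
    then show "\<exists>d>0. \<forall>n. \<forall>\<omega>\<in>space M. 1 / s0 n \<omega> \<le> d \<longrightarrow> 1 / d \<le> r n \<omega> \<longrightarrow> \<bar>(\<Sum>t=1..n. (w n t \<omega>)\<^sup>2) - 1\<bar> \<le> \<epsilon>"
      using d(1) by blast
  qed
  have clt: "weak_conv_m (\<lambda>n. distr M borel (S n)) std_normal_distribution"
    unfolding S_def by (rule weighted_sum_clt[where b = b]) (use w_pred w_sum w_b V_conv b_conv in auto)

  obtain G where G: "\<And>z. z \<ge> 1 \<Longrightarrow> (G has_real_derivative alee_f \<beta> z) (at z)"
    using alee_f_primitive[OF assms(4)] by blast
  have D_ratio: "\<exists>d>0. \<forall>n. \<forall>\<omega>\<in>space M. 1 / s0 n \<omega> \<le> d \<longrightarrow> 1 / d \<le> r n \<omega> \<longrightarrow>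
      0 < D n \<omega> \<and> \<bar>alee_scale \<beta> (r n \<omega>) / D n \<omega> - 1\<bar> \<le> \<epsilon>" if \<epsilon>: "\<epsilon> > 0" for \<epsilon>
  proof -
    \<comment> \<open>Once \<open>s0\<close> is at least 1 the mesh error is at most
      \<open>alee_f \<beta> 1\<close>; a bounded error suffices because \<open>G\<close> tends to
      infinity.\<close>
    have "\<forall>\<^sub>F z in at_top. \<forall>D. (G z - G 1) - alee_f \<beta> 1 \<le> D \<and> D \<le> G z - G 1 \<longrightarrow> 0 < D \<and> \<bar>alee_scale \<beta> z / D - 1\<bar> < \<epsilon>"
      by (rule alee_scale_ratio[OF assms(4) \<epsilon>]) (auto intro!: derivative_eq_intros G)
    then obtain R where R: "\<And>z D. z \<ge> R \<Longrightarrow> (G z - G 1) - alee_f \<beta> 1 \<le> D \<Longrightarrow> D \<le> G z - G 1 \<Longrightarrow> 0 < D \<and> \<bar>alee_scale \<beta> z / D - 1\<bar> < \<epsilon>"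
      unfolding eventually_at_top_linorder by blast
    define d where "d = 1 / max 1 R"
    have d: "d > 0" "d \<le> 1" "R \<le> 1 / d" by (auto simp: d_def)
    have "0 < D n \<omega> \<and> \<bar>alee_scale \<beta> (r n \<omega>) / D n \<omega> - 1\<bar> \<le> \<epsilon>"
      if \<omega>: "\<omega> \<in> space M" and s: "1 / s0 n \<omega> \<le> d" and rd: "1 / d \<le> r n \<omega>" for n \<omega>
    proof -
      have up: "D n \<omega> \<le> G (r n \<omega>) - G 1"
        unfolding D_def w_def r_def using assms(4) s0_pos[OF \<omega>] x_axis[OF _ \<omega>] G by (rule alee_w_x_sum(1))
      have "G (r n \<omega>) - G 1 - alee_f \<beta> 1 / s0 n \<omega> \<le> D n \<omega>"
        unfolding D_def w_def r_def using assms(4) s0_pos[OF \<omega>] x_axis[OF _ \<omega>] G by (rule alee_w_x_sum(2))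
      moreover have "alee_f \<beta> 1 / s0 n \<omega> \<le> alee_f \<beta> 1"
        using mult_left_mono[of "1 / s0 n \<omega>" 1 "alee_f \<beta> 1"] s d(2) f1 by simp
      ultimately have "(G (r n \<omega>) - G 1) - alee_f \<beta> 1 \<le> D n \<omega>" by linarith
      with R[OF _ this up] d rd show ?thesis by (meson less_imp_le order_trans)
    qed
    then show ?thesis using d(1) by blast
  qed
  have Q_conv: "conv_in_prob M (\<lambda>n \<omega>. alee_scale \<beta> (r n \<omega>) / D n \<omega>) 1"
    by (rule eventually_conv) (use D_ratio in meson)
  define C where "C n \<omega> = alee_scale \<beta> (r n \<omega>) / D n \<omega> * (\<sigma> / \<sigma>_hat n \<omega>)" for n \<omega>
  have C_conv: "conv_in_prob M C 1"
    unfolding C_def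
    by (rule conv_in_prob_mult_one[OF assms(1) Q_conv conv_in_prob_const_divide[OF assms(1) assms(19) assms(2)]]) measurable
  have [measurable]: "C n \<in> borel_measurable M" for n unfolding C_def by measurable
  have SC_conv: "conv_in_prob M (\<lambda>n \<omega>. S n \<omega> * C n \<omega> - S n \<omega>) 0"
  \<comment> \<open>\<open>S\<close> has second moment at most 1 by \<open>partial_sum_sq\<close>,
    so a factor tending to 1 changes it negligibly.\<close>
  proof (rule conv_in_prob_mult_tight[OF assms(1) _ _ _ _ C_conv])
    fix n
    note sq = partial_sum_sq[of n "w n" "b n", OF w_pred w_sum _ w_b order_refl]
    show "integrable M (\<lambda>\<omega>. (S n \<omega>)\<^sup>2)" unfolding S_def using sq by simp
    have "(\<integral>\<omega>. (S n \<omega>)\<^sup>2 \<partial>M) = (\<integral>\<omega>. (\<Sum>t=1..n. (w n t \<omega>)\<^sup>2) \<partial>M)" unfolding S_def using sq by simp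
    also have "\<dots> \<le> (\<integral>\<omega>. 1 \<partial>M)"
    proof (rule integral_mono')
      show "integrable M (\<lambda>\<omega>. 1::real)" by simp
    qed (use w_sum in auto)
    finally show "(\<integral>\<omega>. (S n \<omega>)\<^sup>2 \<partial>M) \<le> 1" by (simp add: prob_space)
  qed measurable
  \<comment> \<open>A division by \<open>D\<close> is cancelled, hence the restriction to positive
    \<open>D\<close>. Where \<open>\<sigma>_hat\<close> is 0 both sides are 0, since x / 0 =
    0.\<close>
  have T_eq: "T n \<omega> = S n \<omega> * C n \<omega>" if \<omega>: "\<omega> \<in> space M" and D: "0 < D n \<omega>" for n \<omega>
  proof -
    have s0: "0 < s0 n \<omega>" using s0_pos[OF \<omega>] .
    define h where "h = \<theta>_hat n \<omega> $ k - \<theta> $ k"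
    have "(\<Sum>t=1..n. w n t \<omega> * \<epsilon> t \<omega>) = h * (\<Sum>t=1..n. w n t \<omega> * x t \<omega> $ k)"
      unfolding w_def h_def using x_axis[OF _ \<omega>] y_eq[OF _ \<omega>] assms(17)[OF \<omega>] by (rule alee_error_identity)
    moreover have "(\<Sum>t=1..n. w n t \<omega> * x t \<omega> $ k) = sqrt (s0 n \<omega>) * D n \<omega>"
      using s0 by (simp add: D_def)
    moreover have "(\<Sum>t=1..n. w n t \<omega> * \<epsilon> t \<omega>) = \<sigma> * S n \<omega>"
      using assms(2) by (simp add: S_def sum_distrib_left)
    ultimately have key: "\<sigma> * S n \<omega> / D n \<omega> = h * sqrt (s0 n \<omega>)"
      using D by (simp add: field_simps)
    have "sqrt (alee_s (s0 n) x n k \<omega>) = sqrt (r n \<omega>) * sqrt (s0 n \<omega>)"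
      using s0 by (simp add: r_def flip: real_sqrt_mult)
    then have "T n \<omega> = alee_scale \<beta> (r n \<omega>) * (h * sqrt (s0 n \<omega>)) / \<sigma>_hat n \<omega>"
      unfolding T_def alee_scale_def r_def[symmetric] h_def[symmetric] by simp
    also have "\<dots> = S n \<omega> * C n \<omega>" unfolding key[symmetric] C_def by simp
    finally show ?thesis .
  qed
  have TS_conv: "conv_in_prob M (\<lambda>n \<omega>. T n \<omega> - S n \<omega>) 0"
  proof (rule conv_in_prob_le2[OF assms(1) Y_conv SC_conv])
    fix \<epsilon> :: real assume \<epsilon>: "\<epsilon> > 0"
    \<comment> \<open>The tolerance 1 is arbitrary, as only the positivity of \<open>D\<close> is
      extracted; paths outside this event are absorbed by \<open>Y\<close> exceeding
      \<open>d\<close>.\<close>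
    obtain d where d: "d > 0"
      and pos: "\<And>n \<omega>. \<omega> \<in> space M \<Longrightarrow> 1 / s0 n \<omega> \<le> d \<Longrightarrow> 1 / d \<le> r n \<omega> \<Longrightarrow> 0 < D n \<omega>"
      using D_ratio[of 1] by auto
    have "\<bar>Y n \<omega> - 0\<bar> > min d (\<epsilon> / 2) \<or> \<bar>S n \<omega> * C n \<omega> - S n \<omega> - 0\<bar> > min d (\<epsilon> / 2)"
      if "\<omega> \<in> space M" "\<bar>T n \<omega> - S n \<omega> - 0\<bar> > \<epsilon>" for n \<omega>
    proof (cases "\<bar>Y n \<omega> - 0\<bar> > d")
      case False
      then have "0 < D n \<omega>" using Y_small[OF that(1) d] pos[OF that(1)] by blast
      then have "\<epsilon> < \<bar>S n \<omega> * C n \<omega> - S n \<omega> - 0\<bar>" using T_eq[OF that(1)] that(2) by simp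
      then show ?thesis using \<epsilon> by linarith
    qed linarith
    then show "\<exists>d>0. \<forall>n. \<forall>\<omega>\<in>space M. \<bar>T n \<omega> - S n \<omega> - 0\<bar> > \<epsilon> \<longrightarrow> \<bar>Y n \<omega> - 0\<bar> > d \<or> \<bar>S n \<omega> * C n \<omega> - S n \<omega> - 0\<bar> > d"
      using d \<epsilon> by (intro exI[of _ "min d (\<epsilon> / 2)"]) auto
  qed measurable
  have "weak_conv_m (\<lambda>n. distr M borel (T n)) std_normal_distribution"
    by (rule slutsky_diff[OF assms(1) _ _ real_dist_normal_dist clt TS_conv]) measurable
  then show ?thesis unfolding T_def .
qed

end
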